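(* Let $k \ge 0$ and $d \ge 1$ be integers and let $\psi \in \Psi_d$. If $\psi$ is $2k$ times differentiable at zero, then $\psi$ has $2k + [(d-1)/2]$ continuous derivatives on the open interval $(0,\pi)$.
   Context: For an integer $d\ge 1$, $\mathbb{S}^d=\{x\in\mathbb{R}^{d+1}:\|x\|=1\}$ and $\theta(x,y)=\arccos(\langle x,y\rangle)$ for $x,y\in\mathbb{S}^d$. A function $g:\mathbb{S}^d\times\mathbb{S}^d\to\mathbb{R}$ is positive definite if $\sum_{i=1}^n\sum_{j=1}^n c_ic_j g(x_i,x_j)\ge 0$ for all $n \ge 1$, $x_1,\dots,x_n\in\mathbb{S}^d$ and $c_1,\dots,c_n\in\mathbb{R}$. $\Psi_d$ is the class of continuous functions $\psi:[0,\pi]\to\mathbb{R}$ with $\psi(0)=1$ such that $g(x,y)=\psi(\theta(x,y))$ is positive definite on $\mathbb{S}^d$. Convention: "$\psi$ is $2k$ times differentiable at zero" means that the even continuation $\theta\mapsto\psi(|\theta|)$, $\theta\in[-\pi,\pi]$, has $2k$ (finite) derivatives at $\theta=0$ (no condition if $k=0$). $[x]$ denotes the integer part of $x$. *)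

theory Defs
  imports "HOL-Analysis.Analysis"
begin

definition sphere_dist :: "'a::real_inner \<Rightarrow> 'a \<Rightarrow> real" where
  "sphere_dist x y = arccos (x \<bullet> y)"

definition positive_definite_on :: "'a set \<Rightarrow> ('a \<Rightarrow> 'a \<Rightarrow> real) \<Rightarrow> bool" where
  "positive_definite_on S g \<longleftrightarrow>
     (\<forall>n\<ge>1. \<forall>(x :: nat \<Rightarrow> 'a) (c :: nat \<Rightarrow> real).
        (\<forall>i\<in>{1..n}. x i \<in> S) \<longrightarrow> (\<Sum>i=1..n. \<Sum>j=1..n. c i * c j * g (x i) (x j)) \<ge> 0)"

text \<open>
  The class \<open>\<Psi>\<^sub>d\<close>, where the ambient space \<open>\<real>\<^sup>d\<^sup>+\<^sup>1\<close> of the sphere \<open>\<S>\<^sup>d\<close> is \<open>real ^ 'n\<close>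
  with \<open>CARD('n) = d + 1\<close>. Functions on \<open>[0, \<pi>]\<close> are represented by total functions whose
  values outside \<open>[0, \<pi>]\<close> are irrelevant.
\<close>

definition Psi_class :: "'n::finite itself \<Rightarrow> (real \<Rightarrow> real) set" where
  "Psi_class _ = {\<psi>. continuous_on {0..pi} \<psi> \<and> \<psi> 0 = 1 \<and>
     positive_definite_on (sphere (0 :: real ^ 'n) 1) (\<lambda>x y. \<psi> (sphere_dist x y))}"

text \<open>
  \<open>times_differentiable_at n f x\<close>: the \<open>n\<close>-th derivative of \<open>f\<close> exists at the point \<open>x\<close>. As
  usual, an \<open>(n+1)\<close>-st derivative at \<open>x\<close> presupposes the \<open>n\<close>-th derivative in a neighbourhood of
  \<open>x\<close>; there the iterated \<^const>\<open>deriv\<close> is the genuine \<open>n\<close>-th derivative.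
\<close>

fun times_differentiable_at :: "nat \<Rightarrow> (real \<Rightarrow> real) \<Rightarrow> real \<Rightarrow> bool" where
  "times_differentiable_at 0 f x \<longleftrightarrow> True"
| "times_differentiable_at (Suc n) f x \<longleftrightarrow>
     (\<forall>\<^sub>F y in nhds x. times_differentiable_at n f y) \<and> (deriv ^^ n) f differentiable (at x)"

text \<open>The even continuation near \<open>0\<close> only involves the values of \<open>\<psi>\<close> on \<open>[0, \<pi>]\<close>.\<close>

definition times_differentiable_at_zero :: "nat \<Rightarrow> (real \<Rightarrow> real) \<Rightarrow> bool" where
  "times_differentiable_at_zero n \<psi> \<longleftrightarrow> times_differentiable_at n (\<lambda>\<theta>. \<psi> \<bar>\<theta>\<bar>) 0"

text \<open>Intended for open sets \<open>S\<close>, since the derivatives are two-sided.\<close>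

definition has_continuous_derivatives_on :: "nat \<Rightarrow> (real \<Rightarrow> real) \<Rightarrow> real set \<Rightarrow> bool" where
  "has_continuous_derivatives_on n f S \<longleftrightarrow>
     (\<forall>x\<in>S. times_differentiable_at n f x) \<and> (\<forall>m\<le>n. continuous_on S ((deriv ^^ m) f))"

end

(* Restrict to odd dimension 2m+1 with m = (d-1) div 2, put f t = psi (arccos t), and let T be the
   primitive operator (T g)(x) = integral of g sin over [0, x], so that up to sign T^m psi (x) is an
   m-fold primitive F of f evaluated at cos x.

   For positive definite f(Re <x,y>) on the unit sphere of C^(m+1), Schur's product theorem makes
   f(Re <x,y>) <x,y>^n positive definite too. Averaging over the sphere in x and y, and using unitary
   invariance, gives that the integral of f(Re z) z^n (1-|z|^2)^(m-1) over the disc is nonnegative.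
   Comparing monomials f, this integral is a positive multiple of the cosine coefficient of index
   n+m of F(cos x). Hence these coefficients are nonnegative from index m on. To avoid
   integration on spheres, the uniform measure is replaced by finitely supported measures whose
   moments converge to the right ones; Weierstrass approximation reduces everything to moments.

   If psi has 2k derivatives at zero, it is smooth up to O(x^(2k)) there, so T^m psi is smooth up to
   O(x^(2k+2m)). As in the theory of characteristic functions, for eventually nonnegative cosine
   coefficients a_n the iterated second differences at zero then bound the sum of a_n n^(2k+2m).
   So T^m psi has 2k+2m continuous derivatives, and undoing T costs one derivative per step on (0, pi),
   where sin does not vanish. *)

theory Submission
  imports Defs
begin

section \<open>Functions with continuous derivatives\<close>

text \<open>The gain of m derivatives comes from an imbalance. Since sin vanishes at zero, each
  application of T improves the remainder there by two orders; inside (0, pi) the factor sin does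
  not vanish, and T is worth a single derivative. Nonnegative coefficients carry the order reached
  at the one point zero to the whole circle, and m steps back leave 2k + 2m - m. The same T ties the
  sphere to the circle. Integration by parts turns T into a divided difference of cosine
  coefficients, and on monomials the step from the density (1-|z|^2)^(m-1) to (1-|z|^2)^m obeys the
  same recursion. Complex coordinates make the positivity elementary: <x,y> is a sum of rank-one
  kernels, so its powers replace the Gegenbauer polynomials of the usual zonal expansion.
  Coefficients of index below m come without a sign. There are finitely many, and each summability
  argument splits them off. Only averages of polynomials are taken to the limit. For psi itself the
  finite averages are bounded below, and the approximation error is controlled by their total
  mass.\<close>

fun Ck_on :: "nat \<Rightarrow> (real \<Rightarrow> real) \<Rightarrow> real set \<Rightarrow> bool" where
  "Ck_on 0 f S \<longleftrightarrow> continuous_on S f"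
| "Ck_on (Suc n) f S \<longleftrightarrow> (\<exists>f'. (\<forall>x\<in>S. (f has_real_derivative f' x) (at x)) \<and> Ck_on n f' S)"

lemma Ck_on_imp_continuous_on: "Ck_on n f S \<Longrightarrow> continuous_on S f"
  by (cases n) (auto intro!: continuous_at_imp_continuous_on dest: DERIV_isCont)

lemma Ck_on_Suc_D: "Ck_on (Suc n) f S \<Longrightarrow> Ck_on n f S"
proof (induction n arbitrary: f)
  case 0
  then show ?case by (rule Ck_on_imp_continuous_on[THEN Ck_on.simps(1)[THEN iffD2]])
next
  case (Suc n)
  from Suc.prems obtain f' where "\<forall>x\<in>S. (f has_real_derivative f' x) (at x)" "Ck_on (Suc n) f' S"
    by auto
  with Suc.IH show ?case by auto
qed

lemma Ck_on_cong:
  assumes "open S" "\<And>x. x \<in> S \<Longrightarrow> f x = g x" "Ck_on n f S"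
  shows "Ck_on n g S"
proof (cases n)
  case 0
  with assms show ?thesis by (auto cong: continuous_on_cong)
next
  case (Suc k)
  with assms(3) obtain f' where f': "\<forall>x\<in>S. (f has_real_derivative f' x) (at x)" "Ck_on k f' S"
    by auto
  have "(g has_real_derivative f' x) (at x)" if "x \<in> S" for x
  proof (rule has_field_derivative_transform_within_open)
    show "(f has_real_derivative f' x) (at x)" using f' that by auto
  qed (use assms that in auto)
  with f'(2) Suc show ?thesis by auto
qed

lemma Ck_on_subset: "Ck_on n f S \<Longrightarrow> S' \<subseteq> S \<Longrightarrow> Ck_on n f S'"
  by (induction n arbitrary: f) (fastforce intro: continuous_on_subset)+

lemma Ck_on_const: "Ck_on n (\<lambda>_. c) S"
proof (induction n arbitrary: c)
  case (Suc n)
  show ?case using Suc[of 0] by (auto intro!: exI[of _ "\<lambda>_. 0"])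
qed auto

lemma Ck_on_add: "Ck_on n f S \<Longrightarrow> Ck_on n g S \<Longrightarrow> Ck_on n (\<lambda>x. f x + g x) S"
proof (induction n arbitrary: f g)
  case (Suc n)
  from Suc.prems obtain f' g' where
    "\<forall>x\<in>S. (f has_real_derivative f' x) (at x)" "Ck_on n f' S"
    "\<forall>x\<in>S. (g has_real_derivative g' x) (at x)" "Ck_on n g' S" by auto
  with Suc.IH[of f' g'] show ?case
    by (auto intro!: exI[of _ "\<lambda>x. f' x + g' x"] derivative_intros)
qed (auto intro: continuous_intros)

lemma Ck_on_mult: "Ck_on n f S \<Longrightarrow> Ck_on n g S \<Longrightarrow> Ck_on n (\<lambda>x. f x * g x) S"
proof (induction n arbitrary: f g)
  case (Suc n)
  from Suc.prems obtain f' g' where *: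
    "\<forall>x\<in>S. (f has_real_derivative f' x) (at x)" "Ck_on n f' S"
    "\<forall>x\<in>S. (g has_real_derivative g' x) (at x)" "Ck_on n g' S" by auto
  have "Ck_on n (\<lambda>x. f' x * g x + g' x * f x) S"
    using Suc.prems * by (intro Ck_on_add Suc.IH) (auto simp del: Ck_on.simps dest: Ck_on_Suc_D)
  with * show ?case
    by (auto intro!: exI[of _ "\<lambda>x. f' x * g x + g' x * f x"] derivative_eq_intros)
qed (auto intro: continuous_intros)

lemma Ck_on_ident: "Ck_on n (\<lambda>x. x) S"
proof (cases n)
  case (Suc k)
  then show ?thesis using Ck_on_const[of k 1 S] by (auto intro!: exI[of _ "\<lambda>_. 1"])
qed auto

lemma Ck_on_power: "Ck_on n (\<lambda>x. x ^ i) S"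
  by (induction i) (simp_all add: Ck_on_const Ck_on_mult[OF Ck_on_ident] del: Ck_on.simps)

text \<open>The shift \<open>c\<close> closes the family under differentiation: the derivative is
  the sine shifted by a further quarter period.\<close>

lemma Ck_on_sin_shift: "Ck_on n (\<lambda>x. sin (x + c)) S"
proof (induction n arbitrary: c)
  case (Suc n)
  have "sin (x + (c + pi / 2)) = cos (x + c)" for x
    by (simp add: sin_add cos_add)
  with Suc[of "c + pi / 2"] have "Ck_on n (\<lambda>x. cos (x + c)) S" by simp
  moreover have "((\<lambda>x. sin (x + c)) has_real_derivative cos (x + c)) (at x)" for x
    by (rule derivative_eq_intros refl)+ simp
  ultimately show ?case by (auto intro!: exI[of _ "\<lambda>x. cos (x + c)"])
qed (auto intro!: continuous_intros)

lemma Ck_on_sin: "Ck_on n sin S"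
  using Ck_on_sin_shift[of n 0 S] by simp

text \<open>The derivative -f'/f^2 involves the inverse again, but only to order \<open>n\<close>,
  where the induction hypothesis supplies it.\<close>

lemma Ck_on_inverse:
  "Ck_on n f S \<Longrightarrow> (\<And>x. x \<in> S \<Longrightarrow> f x \<noteq> 0) \<Longrightarrow> Ck_on n (\<lambda>x. inverse (f x)) S"
proof (induction n arbitrary: f)
  case (Suc n)
  from Suc.prems obtain f' where *:
    "\<forall>x\<in>S. (f has_real_derivative f' x) (at x)" "Ck_on n f' S"
    unfolding Ck_on.simps(2) by blast
  have inv: "Ck_on n (\<lambda>x. inverse (f x)) S"
    by (rule Suc.IH[OF Ck_on_Suc_D[OF Suc.prems(1)] Suc.prems(2)])
  have "Ck_on n (\<lambda>x. (- 1) * (inverse (f x) * f' x * inverse (f x))) S"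
    by (intro Ck_on_mult Ck_on_const inv *)
  moreover have "((\<lambda>x. inverse (f x)) has_real_derivative
      (- 1) * (inverse (f x) * f' x * inverse (f x))) (at x)" if "x \<in> S" for x
    using DERIV_inverse'[OF *(1)[rule_format, OF that] Suc.prems(2)[OF that]] by simp
  ultimately show ?case
    unfolding Ck_on.simps(2)
    by (intro exI[of _ "\<lambda>x. (- 1) * (inverse (f x) * f' x * inverse (f x))"]) blast
qed (auto intro!: continuous_on_inverse)

text \<open>\<open>times_differentiable_at\<close> appends the last derivative, whereas
  \<open>Ck_on\<close> starts with the first one. This lemma and
  \<open>times_differentiable_at_deriv\<close> translate between the two orders; openness of
  \<open>S\<close> supplies the neighbourhoods that further derivatives presuppose.\<close>

lemma times_differentiable_at_SucI:
  assumes "open S" "\<And>x. x \<in> S \<Longrightarrow> f differentiable (at x)"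
    "\<And>x. x \<in> S \<Longrightarrow> times_differentiable_at n (deriv f) x" "x \<in> S"
  shows "times_differentiable_at (Suc n) f x"
  using assms(3,4)
proof (induction n arbitrary: x)
  case 0
  have "times_differentiable_at 0 f = (\<lambda>_. True)" by auto
  with 0 show ?case using assms(2) by simp
next
  case (Suc n)
  have "times_differentiable_at n (deriv f) y" if "y \<in> S" for y
    using Suc.prems(1)[OF that] by (auto dest: eventually_nhds_x_imp_x)
  then have "times_differentiable_at (Suc n) f y" if "y \<in> S" for y
    using Suc.IH that by blast
  then have "\<forall>\<^sub>F y in nhds x. times_differentiable_at (Suc n) f y"
    using assms(1) Suc.prems(2) by (auto simp: eventually_nhds simp del: times_differentiable_at.simps)
  moreover have "(deriv ^^ Suc n) f differentiable (at x)"
    using Suc.prems by (simp add: funpow_swap1)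
  ultimately show ?case unfolding times_differentiable_at.simps(2)[of "Suc n"] by blast
qed

lemma Ck_on_imp_has_continuous_derivatives_on:
  assumes "open S" "Ck_on n f S"
  shows "has_continuous_derivatives_on n f S"
  using assms(2)
proof (induction n arbitrary: f)
  case 0
  then show ?case by (auto simp: has_continuous_derivatives_on_def)
next
  case (Suc n)
  from Suc.prems obtain f' where *:
    "\<forall>x\<in>S. (f has_real_derivative f' x) (at x)" "Ck_on n f' S" by auto
  have eq: "f' x = deriv f x" if "x \<in> S" for x
    using * that by (metis DERIV_imp_deriv)
  have "Ck_on n (deriv f) S"
    by (rule Ck_on_cong[OF assms(1) eq *(2)])
  then have IH: "has_continuous_derivatives_on n (deriv f) S" by (rule Suc.IH)
  have "times_differentiable_at (Suc n) f x" if "x \<in> S" for x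
    using IH * that
    by (intro times_differentiable_at_SucI[OF assms(1)])
       (auto simp: has_continuous_derivatives_on_def real_differentiable_def)
  moreover have "continuous_on S ((deriv ^^ j) f)" if "j \<le> Suc n" for j
    using IH Ck_on_imp_continuous_on[OF Suc.prems] that
    by (cases j) (auto simp: has_continuous_derivatives_on_def funpow_swap1)
  ultimately show ?case by (auto simp: has_continuous_derivatives_on_def)
qed

section \<open>Approximation at zero from differentiability at zero\<close>

lemma times_differentiable_at_Suc_imp_differentiable:
  "times_differentiable_at (Suc n) f x \<Longrightarrow> f differentiable (at x)"
  by (induction n) (auto dest: eventually_nhds_x_imp_x)

lemma times_differentiable_at_deriv:
  "times_differentiable_at (Suc n) f x \<Longrightarrow> times_differentiable_at n (deriv f) x"
proof (induction n arbitrary: x)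
  case (Suc n)
  from Suc.prems have "\<forall>\<^sub>F y in nhds x. times_differentiable_at (Suc n) f y"
    unfolding times_differentiable_at.simps(2)[of "Suc n"] by blast
  then have "\<forall>\<^sub>F y in nhds x. times_differentiable_at n (deriv f) y"
    by eventually_elim (rule Suc.IH)
  with Suc.prems show ?case by (simp add: funpow_swap1)
qed simp

text \<open>The mean value inequality on [-|x|, |x|]: one integration from zero raises the order of
  vanishing by one. It serves for Taylor remainders, second differences and
  \<open>sin_primitive\<close>.\<close>

lemma increment_bound_zero:
  fixes r :: "real \<Rightarrow> real"
  assumes "\<And>x. \<bar>x\<bar> \<le> \<delta> \<Longrightarrow> (r has_real_derivative r' x) (at x)"
    and "\<And>x. \<bar>x\<bar> \<le> \<delta> \<Longrightarrow> \<bar>r' x\<bar> \<le> C * \<bar>x\<bar> ^ p" and "r 0 = 0" and "\<bar>x\<bar> \<le> \<delta>" and "C \<ge> 0"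
  shows "\<bar>r x\<bar> \<le> C * \<bar>x\<bar> ^ Suc p"
proof -
  have "norm (r x - r 0) \<le> (C * \<bar>x\<bar> ^ p) * norm (x - 0)"
  proof (rule field_differentiable_bound[of "{-\<bar>x\<bar>..\<bar>x\<bar>}"])
    fix z assume z: "z \<in> {-\<bar>x\<bar>..\<bar>x\<bar>}"
    then show "(r has_field_derivative r' z) (at z within {-\<bar>x\<bar>..\<bar>x\<bar>})"
      using assms(4) by (intro has_field_derivative_at_within[OF assms(1)]) auto
    have "\<bar>r' z\<bar> \<le> C * \<bar>z\<bar> ^ p" using z assms(4) by (intro assms(2)) auto
    also have "\<dots> \<le> C * \<bar>x\<bar> ^ p" using z assms(5) by (intro mult_left_mono power_mono) auto
    finally show "norm (r' z) \<le> C * \<bar>x\<bar> ^ p" by simp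
  qed auto
  then show ?thesis using \<open>r 0 = 0\<close> by (simp add: mult_ac)
qed

text \<open>Stores the hypothesis at zero in a form that survives \<open>sin_primitive\<close>. The
  smooth part may be any smooth function, since multiplication by sin leaves the polynomials; of the
  remainder only the size is recorded, not its derivatives.\<close>

definition smooth_plus_bigo :: "nat \<Rightarrow> (real \<Rightarrow> real) \<Rightarrow> bool" where
  "smooth_plus_bigo p g \<longleftrightarrow> (\<exists>s C \<delta>. (\<forall>n. Ck_on n s UNIV) \<and> C \<ge> 0 \<and> \<delta> > 0 \<and>
     (\<forall>x. \<bar>x\<bar> \<le> \<delta> \<longrightarrow> \<bar>g x - s x\<bar> \<le> C * \<bar>x\<bar> ^ p))"

text \<open>Taylor's formula, obtained by integrating the approximation of \<open>deriv g\<close>.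
  The base case uses only the difference quotient, so the highest derivative enters at the single
  point 0.\<close>

lemma differentiable_imp_polynomial_approx:
  assumes "times_differentiable_at (Suc n) g 0"
  shows "\<exists>a N C \<delta>. C \<ge> 0 \<and> \<delta> > 0 \<and>
     (\<forall>x. \<bar>x\<bar> \<le> \<delta> \<longrightarrow> \<bar>g x - (\<Sum>i<(N::nat). a i * x ^ i)\<bar> \<le> C * \<bar>x\<bar> ^ Suc n)"
  using assms
proof (induction n arbitrary: g)
  case 0
  then obtain D where "(g has_real_derivative D) (at 0)" by (auto simp: real_differentiable_def)
  then have "((\<lambda>h. (g h - g 0) / h) \<longlongrightarrow> D) (at 0)" by (simp add: DERIV_def)
  then have "\<forall>\<^sub>F h in at 0. dist ((g h - g 0) / h) D < 1" by (rule tendstoD) simp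
  then obtain e where e: "e > 0" "\<And>h. h \<noteq> 0 \<Longrightarrow> \<bar>h\<bar> < e \<Longrightarrow> dist ((g h - g 0) / h) D < 1"
    by (auto simp: eventually_at)
  have "\<bar>g x - g 0\<bar> \<le> (\<bar>D\<bar> + 1) * \<bar>x\<bar>" if "\<bar>x\<bar> \<le> e / 2" for x
  proof (cases "x = 0")
    case False
    then have "\<bar>(g x - g 0) / x\<bar> \<le> \<bar>D\<bar> + 1" using e(2)[of x] e(1) that by (auto simp: dist_real_def)
    with False show ?thesis by (simp add: field_simps abs_divide)
  qed auto
  then show ?case using e(1)
    by (intro exI[of _ "\<lambda>_. g 0"] exI[of _ 1] exI[of _ "\<bar>D\<bar> + 1"] exI[of _ "e / 2"]) auto
next
  case (Suc n)
  have "times_differentiable_at (Suc n) (deriv g) 0"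
    using Suc.prems by (rule times_differentiable_at_deriv)
  from Suc.IH[OF this] obtain a N C \<delta> where IH: "C \<ge> 0" "\<delta> > 0"
    "\<And>x. \<bar>x\<bar> \<le> \<delta> \<Longrightarrow> \<bar>deriv g x - (\<Sum>i<(N::nat). a i * x ^ i)\<bar> \<le> C * \<bar>x\<bar> ^ Suc n"
    by blast
  have "\<forall>\<^sub>F y in nhds 0. times_differentiable_at (Suc n) g y"
    using Suc.prems unfolding times_differentiable_at.simps(2)[of "Suc n"] by blast
  then have "\<forall>\<^sub>F y in nhds 0. g differentiable (at y)"
    by eventually_elim (rule times_differentiable_at_Suc_imp_differentiable)
  then obtain e where e: "e > 0" "\<And>y. \<bar>y\<bar> < e \<Longrightarrow> g differentiable (at y)"
    by (auto simp: eventually_nhds_metric dist_real_def)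
  \<comment> \<open>Coefficients of the primitive, with value \<open>g 0\<close> at zero, of the
    polynomial with coefficients \<open>a\<close>.\<close>
  define b where "b i = (case i of 0 \<Rightarrow> g 0 | Suc j \<Rightarrow> a j / Suc j)" for i
  have b: "(\<Sum>i<Suc N. b i * x ^ i) = g 0 + (\<Sum>i<N. a i / Suc i * x ^ Suc i)" for x
    by (subst sum.lessThan_Suc_shift) (simp add: b_def)
  define \<delta>' where "\<delta>' = min \<delta> (e / 2)"
  have "\<bar>g x - (\<Sum>i<Suc N. b i * x ^ i)\<bar> \<le> C * \<bar>x\<bar> ^ Suc (Suc n)" if "\<bar>x\<bar> \<le> \<delta>'" for x
  proof (rule increment_bound_zero[OF _ _ _ that \<open>C \<ge> 0\<close>])
    fix y assume y: "\<bar>y\<bar> \<le> \<delta>'"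
    then have "(g has_real_derivative deriv g y) (at y)"
      using e unfolding \<delta>'_def
      by (simp add: DERIV_deriv_iff_real_differentiable)
    moreover have "((\<lambda>x. a i / Suc i * x ^ Suc i) has_real_derivative a i * y ^ i) (at y)" for i
      by (rule derivative_eq_intros refl)+ (simp del: of_nat_Suc)
    ultimately show "((\<lambda>x. g x - (\<Sum>i<Suc N. b i * x ^ i)) has_real_derivative
        deriv g y - (\<Sum>i<N. a i * y ^ i)) (at y)"
      unfolding b
      by (intro DERIV_diff DERIV_sum DERIV_add[where D=0, simplified] DERIV_const) auto
    show "\<bar>deriv g y - (\<Sum>i<N. a i * y ^ i)\<bar> \<le> C * \<bar>y\<bar> ^ Suc n"
      using y IH unfolding \<delta>'_def by simp
  qed (simp add: b b_def)
  moreover have "\<delta>' > 0" using e IH by (simp add: \<delta>'_def)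
  ultimately show ?case using IH(1)
    by (intro exI[of _ b] exI[of _ "Suc N"] exI[of _ C] exI[of _ \<delta>']) simp
qed

lemma Ck_on_sum: "(\<And>i. i < N \<Longrightarrow> Ck_on n (f i) S) \<Longrightarrow> Ck_on n (\<lambda>x. \<Sum>i<(N::nat). f i x) S"
  by (induction N) (simp_all add: Ck_on_const Ck_on_add del: Ck_on.simps)

lemma smooth_plus_bigo_if_times_differentiable:
  assumes "continuous_on {-1..1} g" "times_differentiable_at n g 0"
  shows "smooth_plus_bigo n g"
proof (cases n)
  case 0
  \<comment> \<open>For order 0 the remainder has only to be bounded near zero, so the smooth part
    can be 0.\<close>
  have "compact (g ` {-1..1})"
    by (intro compact_continuous_image assms(1)) simp
  then obtain C where "\<And>x. x \<in> {-1..1} \<Longrightarrow> \<bar>g x\<bar> \<le> C"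
    by (force simp: bounded_iff dest: compact_imp_bounded)
  then have "\<bar>g x\<bar> \<le> C" if "\<bar>x\<bar> \<le> 1" for x using that by (simp add: abs_le_iff)
  moreover from this[of 0] have "C \<ge> 0" by simp
  ultimately show ?thesis unfolding smooth_plus_bigo_def 0
    by (intro exI[of _ "\<lambda>_. 0"] exI[of _ C] exI[of _ 1]) (auto intro: Ck_on_const)
next
  case (Suc k)
  from differentiable_imp_polynomial_approx[OF assms(2)[unfolded Suc]] obtain a N C \<delta> where
    *: "C \<ge> 0" "\<delta> > 0" "\<And>x. \<bar>x\<bar> \<le> \<delta> \<Longrightarrow> \<bar>g x - (\<Sum>i<(N::nat). a i * x ^ i)\<bar> \<le> C * \<bar>x\<bar> ^ n"
    unfolding Suc by auto
  have "Ck_on l (\<lambda>x. \<Sum>i<N. a i * x ^ i) UNIV" for l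
    by (intro Ck_on_sum Ck_on_mult Ck_on_const Ck_on_power)
  with * show ?thesis unfolding smooth_plus_bigo_def
    by (intro exI[of _ "\<lambda>x. \<Sum>i<N. a i * x ^ i"] exI[of _ C] exI[of _ \<delta>]) simp
qed

section \<open>Cosine series\<close>

definition cos_coeff :: "(real \<Rightarrow> real) \<Rightarrow> nat \<Rightarrow> real" where
  "cos_coeff g n = integral {0..pi} (\<lambda>x. g x * cos (real n * x))"

lemma integral_cos_int:
  "integral {0..pi} (\<lambda>x. cos (of_int k * x)) = (if k = 0 then pi else 0)"
proof (cases "k = 0")
  case False
  have "((\<lambda>x. cos (of_int k * x)) has_integral
      (sin (of_int k * pi) / of_int k - sin (of_int k * 0) / of_int k)) {0..pi}"
    using False
    by (intro fundamental_theorem_of_calculus)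
       (auto intro!: derivative_eq_intros simp flip: has_real_derivative_iff_has_vector_derivative)
  moreover have "sin (of_int k * pi) = 0" by (simp add: sin_zero_iff_int2)
  ultimately show ?thesis using False by (simp add: integral_unique)
qed simp

lemma integral_cos_diff:
  "integral {0..pi} (\<lambda>x. cos ((real j - real l) * x)) = (if j = l then pi else 0)"
  using integral_cos_int[of "int j - int l"] by simp

lemma cos_coeff_cos:
  "cos_coeff (\<lambda>x. cos (real k * x)) n = (if n = k then if n = 0 then pi else pi / 2 else 0)"
proof -
  have eq: "cos (real k * x) * cos (real n * x)
      = cos (of_int (int k - int n) * x) / 2 + cos (of_int (int k + int n) * x) / 2" for x
    by (simp add: cos_times_cos algebra_simps add_divide_distrib)
  show ?thesis
    unfolding cos_coeff_def eq
    by (subst integral_add)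
       (auto intro!: integrable_continuous_interval continuous_intros simp: integral_cos_int
         simp del: of_int_diff of_int_add)
qed

lemma cos_coeff_diff:
  assumes "continuous_on {0..pi} f" "continuous_on {0..pi} g"
  shows "cos_coeff (\<lambda>x. f x - g x) n = cos_coeff f n - cos_coeff g n"
  unfolding cos_coeff_def left_diff_distrib
  by (intro integral_diff integrable_continuous_interval continuous_intros assms)

lemma cos_coeff_cmult: "cos_coeff (\<lambda>x. c * f x) n = c * cos_coeff f n"
  unfolding cos_coeff_def by (simp add: mult.assoc)

lemma cos_coeff_sum:
  assumes "\<And>i. i < N \<Longrightarrow> continuous_on {0..pi} (f i)"
  shows "cos_coeff (\<lambda>x. \<Sum>i<(N::nat). f i x) n = (\<Sum>i<N. cos_coeff (f i) n)"
  unfolding cos_coeff_def sum_distrib_right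
  by (intro integral_sum integrable_continuous_interval continuous_intros) (simp_all add: assms)

lemma abs_cos_coeff_le:
  assumes "continuous_on {0..pi} g" "\<And>x. x \<in> {0..pi} \<Longrightarrow> \<bar>g x\<bar> \<le> B"
  shows "\<bar>cos_coeff g n\<bar> \<le> pi * B"
proof -
  have "norm (integral {0..pi} (\<lambda>x. g x * cos (real n * x))) \<le> B * (pi - 0)"
  proof (intro integral_bound)
    fix x assume x: "x \<in> {0..pi}"
    have "\<bar>g x\<bar> * \<bar>cos (real n * x)\<bar> \<le> B * 1"
      using assms(2)[OF x] by (intro mult_mono) (auto intro: order_trans[OF abs_ge_zero])
    then show "norm (g x * cos (real n * x)) \<le> B" by (simp add: abs_mult)
  qed (auto intro!: continuous_intros assms(1))
  then show ?thesis by (simp add: cos_coeff_def mult.commute)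
qed

text \<open>The double sum is the squared modulus of the sum of exp(i j x) over j < N.\<close>

lemma fejer_kernel_nonneg:
  "0 \<le> (\<Sum>j<N. \<Sum>l<N. cos ((real j - real l) * x))"
proof -
  have "(\<Sum>j<N. \<Sum>l<N. cos ((real j - real l) * x))
      = (\<Sum>j<N. cos (real j * x)) * (\<Sum>l<N. cos (real l * x))
      + (\<Sum>j<N. sin (real j * x)) * (\<Sum>l<N. sin (real l * x))"
    unfolding sum_product sum.distrib[symmetric] by (simp add: cos_diff left_diff_distrib)
  then show ?thesis by simp
qed

text \<open>Testing against the Fejer kernel of order \<open>2 * M\<close>.\<close>

lemma sum_cos_coeff_le:
  assumes g: "continuous_on {0..pi} g" "\<And>x. x \<in> {0..pi} \<Longrightarrow> \<bar>g x\<bar> \<le> B"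
    and nonneg: "\<And>n. 0 \<le> cos_coeff g n"
  shows "(\<Sum>n<M. cos_coeff g n) \<le> 2 * pi * B"
proof (cases "M = 0")
  case True
  have "0 \<le> B" using order_trans[OF abs_ge_zero g(2)[of 0]] by simp
  then show ?thesis using True by simp
next
  case False
  define N where "N = 2 * M"
  define K where "K x = (\<Sum>j<N. \<Sum>l<N. cos ((real j - real l) * x))" for x
  have contK: "continuous_on {0..pi} K" unfolding K_def by (intro continuous_intros)
  \<comment> \<open>Since \<open>K\<close> is nonnegative, \<open>g\<close> may be replaced by its
    bound; afterwards only the diagonal terms of \<open>K\<close> contribute.\<close>
  have "integral {0..pi} (\<lambda>x. g x * K x) \<le> integral {0..pi} (\<lambda>x. B * K x)"
  proof (rule integral_le)
    fix x assume "x \<in> {0..pi}"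
    then show "g x * K x \<le> B * K x"
      using g(2)[of x] fejer_kernel_nonneg[where N=N and x=x] unfolding K_def
      by (intro mult_right_mono) auto
  qed (intro integrable_continuous_interval continuous_intros contK g)+
  also have "integral {0..pi} (\<lambda>x. B * K x) = B * (\<Sum>j<N. \<Sum>l<N. if j = l then pi else 0)"
  proof -
    have "integral {0..pi} K
        = (\<Sum>j<N. \<Sum>l<N. integral {0..pi} (\<lambda>x. cos ((real j - real l) * x)))"
      unfolding K_def
      by (subst integral_sum, simp, intro integrable_continuous_interval continuous_intros,
        intro sum.cong refl integral_sum integrable_continuous_interval continuous_intros) simp
    then show ?thesis unfolding integral_cos_diff by simp
  qed
  also have "\<dots> = B * (pi * real N)" by simp
  also have "integral {0..pi} (\<lambda>x. g x * K x) = (\<Sum>j<N. \<Sum>l<N. cos_coeff g ((j - l) + (l - j)))"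
  proof -
    have cos_eq: "cos ((real j - real l) * x) = cos (real ((j - l) + (l - j)) * x)" for j l x
    proof (cases "l \<le> j")
      case False
      have "cos ((real j - real l) * x) = cos (- ((real j - real l) * x))" by (rule cos_minus[symmetric])
      also have "- ((real j - real l) * x) = real ((j - l) + (l - j)) * x"
        using False by (simp add: of_nat_diff left_diff_distrib)
      finally show ?thesis .
    qed (simp add: of_nat_diff)
    have "integral {0..pi} (\<lambda>x. g x * K x)
       = integral {0..pi} (\<lambda>x. \<Sum>j<N. \<Sum>l<N. g x * cos (real ((j - l) + (l - j)) * x))"
      unfolding K_def sum_distrib_left cos_eq ..
    also have "\<dots> = (\<Sum>j<N. \<Sum>l<N. integral {0..pi} (\<lambda>x. g x * cos (real ((j - l) + (l - j)) * x)))"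
      by (subst integral_sum, simp, intro integrable_continuous_interval continuous_intros g,
        intro sum.cong refl integral_sum integrable_continuous_interval continuous_intros g) simp
    finally show ?thesis unfolding cos_coeff_def .
  qed
  finally have upper: "(\<Sum>j<N. \<Sum>l<N. cos_coeff g ((j - l) + (l - j))) \<le> B * (pi * real N)" .
  \<comment> \<open>For each \<open>j < M\<close> the indices \<open>l\<close> from \<open>j\<close>
    to \<open>j + M - 1\<close> stay below \<open>N\<close> and run through all differences below
    \<open>M\<close>. The square thus contains \<open>M\<close> copies of the sum, against an upper
    bound linear in \<open>N = 2 * M\<close>.\<close>
  have "real M * (\<Sum>n<M. cos_coeff g n) = (\<Sum>j<M. \<Sum>n<M. cos_coeff g n)" by simp
  also have "\<dots> = (\<Sum>j<M. \<Sum>l\<in>{j..<j+M}. cos_coeff g ((j - l) + (l - j)))"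
  proof (rule sum.cong[OF refl])
    fix j
    show "(\<Sum>n<M. cos_coeff g n) = (\<Sum>l\<in>{j..<j+M}. cos_coeff g ((j - l) + (l - j)))"
      by (rule sum.reindex_bij_witness[of _ "\<lambda>l. l - j" "\<lambda>n. n + j"]) auto
  qed
  also have "\<dots> \<le> (\<Sum>j<M. \<Sum>l<N. cos_coeff g ((j - l) + (l - j)))"
    by (intro sum_mono sum_mono2) (auto simp: N_def nonneg)
  also have "\<dots> \<le> (\<Sum>j<N. \<Sum>l<N. cos_coeff g ((j - l) + (l - j)))"
    by (intro sum_mono2) (auto simp: N_def nonneg intro!: sum_nonneg)
  also note upper
  finally show ?thesis using False by (simp add: N_def field_simps)
qed

text \<open>Completeness of the cosines on [0, pi]. Product formulas extend the vanishing to
  \<open>g\<close> times powers of cos; Weierstrass approximation in t = cos x then makes the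
  integral of g^2 arbitrarily small.\<close>

lemma cos_coeff_zero_imp_zero:
  assumes g: "continuous_on {0..pi} g" and zero: "\<And>n. cos_coeff g n = 0" and x: "x \<in> {0..pi}"
  shows "g x = 0"
proof -
  have cont: "continuous_on {0..pi} (\<lambda>x. g x * cos x ^ j)" for j
    by (intro continuous_intros g)
  have pow: "cos_coeff (\<lambda>x. g x * cos x ^ j) n = 0" for j n
  proof (induction j arbitrary: n)
    case (Suc j)
    show ?case
    proof (cases n)
      case 0
      have "cos_coeff (\<lambda>x. g x * cos x ^ Suc j) 0 = cos_coeff (\<lambda>x. g x * cos x ^ j) 1"
        unfolding cos_coeff_def by (simp add: mult_ac)
      then show ?thesis using Suc 0 by simp
    next
      case (Suc n')
      have "g x * cos x ^ Suc j * cos (real n * x) =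
          1 / 2 * (g x * cos x ^ j * cos (real n' * x)) + 1 / 2 * (g x * cos x ^ j * cos (real (n + 1) * x))" for x
      proof -
        have "cos x * cos (real n * x) = (cos (real n' * x) + cos (real (n + 1) * x)) / 2"
          using cos_times_cos[of "real n * x" x] by (simp add: Suc algebra_simps)
        then have "g x * cos x ^ j * (cos x * cos (real n * x))
            = g x * cos x ^ j * ((cos (real n' * x) + cos (real (n + 1) * x)) / 2)" by simp
        moreover have "g x * cos x ^ Suc j * cos (real n * x) = g x * cos x ^ j * (cos x * cos (real n * x))"
          by (simp add: mult_ac)
        ultimately show ?thesis by (simp add: algebra_simps add_divide_distrib)
      qed
      then have "cos_coeff (\<lambda>x. g x * cos x ^ Suc j) n =
          1 / 2 * cos_coeff (\<lambda>x. g x * cos x ^ j) n' + 1 / 2 * cos_coeff (\<lambda>x. g x * cos x ^ j) (n + 1)"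
        unfolding cos_coeff_def
        by (simp only:) (subst integral_add, (intro integrable_continuous_interval continuous_intros g)+, simp)
      then show ?thesis using Suc.IH by simp
    qed
  qed (simp add: zero)
  have "compact (g ` {0..pi})" by (intro compact_continuous_image g) auto
  then obtain B where B: "\<And>x. x \<in> {0..pi} \<Longrightarrow> \<bar>g x\<bar> \<le> B"
    by (force simp: bounded_iff dest: compact_imp_bounded)
  have B0: "0 \<le> B" using order_trans[OF abs_ge_zero B[of 0]] by simp
  have small: "integral {0..pi} (\<lambda>x. g x * g x) \<le> e * (B * pi)" if "e > 0" for e
  proof -
    have "continuous_on {-1..1} (\<lambda>t. g (arccos t))"
      by (intro continuous_on_compose2[OF g] continuous_on_arccos' ) (auto simp: arccos_lbound arccos_ubound)
    then have "\<exists>p. real_polynomial_function p \<and> (\<forall>t\<in>{-1..1}. \<bar>g (arccos t) - p t\<bar> < e)"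
      using Stone_Weierstrass_real_polynomial_function[OF compact_Icc _ \<open>e > 0\<close>] by metis
    then obtain p where p: "real_polynomial_function p" "\<And>t. t \<in> {-1..1} \<Longrightarrow> \<bar>g (arccos t) - p t\<bar> < e"
      by blast
    from p(1) obtain a N where a: "p = (\<lambda>t. \<Sum>i\<le>N. a i * t ^ i)"
      unfolding real_polynomial_function_iff_sum by auto
    have contp: "continuous_on {0..pi} (\<lambda>x. p (cos x))" unfolding a by (intro continuous_intros)
    have "integral {0..pi} (\<lambda>x. g x * p (cos x)) = (\<Sum>i\<le>N. a i * cos_coeff (\<lambda>x. g x * cos x ^ i) 0)"
      unfolding a sum_distrib_left cos_coeff_def
      by (subst integral_sum) (auto intro!: integrable_continuous_interval continuous_intros g
        simp: mult.left_commute[of _ "a _"])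
    then have "integral {0..pi} (\<lambda>x. g x * p (cos x)) = 0" by (simp add: pow)
    then have "integral {0..pi} (\<lambda>x. g x * g x) = integral {0..pi} (\<lambda>x. g x * (g x - p (cos x)))"
      unfolding right_diff_distrib
      by (subst integral_diff) (auto intro!: integrable_continuous_interval continuous_intros g contp)
    also have "norm \<dots> \<le> (e * B) * (pi - 0)"
    proof (intro integral_bound)
      fix x assume x: "x \<in> {0..pi}"
      then have "\<bar>g x - p (cos x)\<bar> \<le> e" using p(2)[of "cos x"] by (simp add: arccos_cos)
      then have "\<bar>g x\<bar> * \<bar>g x - p (cos x)\<bar> \<le> B * e"
        using B[OF x] B0 by (intro mult_mono) auto
      then show "norm (g x * (g x - p (cos x))) \<le> e * B" by (simp add: abs_mult mult.commute)
    qed (auto intro!: continuous_intros g contp)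
    finally show ?thesis by (simp add: mult_ac)
  qed
  have "integral {0..pi} (\<lambda>x. g x * g x) \<le> 0"
  proof (rule field_le_epsilon)
    fix e :: real assume e: "0 < e"
    \<comment> \<open>The added 1 keeps the denominator positive when \<open>B = 0\<close>.\<close>
    have "integral {0..pi} (\<lambda>x. g x * g x) \<le> e / (B * pi + 1) * (B * pi)"
      using e B0 by (intro small divide_pos_pos add_nonneg_pos) auto
    also have "\<dots> \<le> e"
    proof -
      have "0 < B * pi + 1" using B0 by (intro add_nonneg_pos) auto
      then show ?thesis using e by (simp add: pos_divide_le_eq distrib_left)
    qed
    finally show "integral {0..pi} (\<lambda>x. g x * g x) \<le> 0 + e" by simp
  qed
  moreover have "integral {0..pi} (\<lambda>x. g x * g x) \<ge> 0" by (intro integral_nonneg integrable_continuous_interval continuous_intros g) auto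
  ultimately have "integral {0..pi} (\<lambda>x. g x * g x) = 0" by simp
  then have "\<forall>x\<in>{0..pi}. g x * g x = 0"
    by (subst (asm) integral_eq_0_iff) (auto intro!: continuous_intros g)
  with x show ?thesis by simp
qed


text \<open>Subtracting a cosine polynomial removes the first \<open>m\<close> coefficients, so all
  that remain are nonnegative and the Fejer bound applies to their partial sums.\<close>

lemma summable_cos_coeff:
  assumes g: "continuous_on {0..pi} g" and nonneg: "\<And>n. m \<le> n \<Longrightarrow> 0 \<le> cos_coeff g n"
  shows "summable (\<lambda>n. \<bar>cos_coeff g n\<bar>)"
proof -
  define a where "a n = (if n = 0 then 1 else 2) / pi * cos_coeff g n" for n
  define g' where "g' x = g x - (\<Sum>k<m. a k * cos (real k * x))" for x
  have contg': "continuous_on {0..pi} g'" unfolding g'_def by (intro continuous_intros g)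
  have coeff: "cos_coeff g' n = (if n < m then 0 else cos_coeff g n)" for n
  proof -
    have "cos_coeff g' n = cos_coeff g n - cos_coeff (\<lambda>x. \<Sum>k<m. a k * cos (real k * x)) n"
      unfolding g'_def by (rule cos_coeff_diff) (intro continuous_intros g)+
    also have "cos_coeff (\<lambda>x. \<Sum>k<m. a k * cos (real k * x)) n
        = (\<Sum>k<m. a k * cos_coeff (\<lambda>x. cos (real k * x)) n)"
      by (subst cos_coeff_sum) (auto intro!: continuous_intros simp: cos_coeff_cmult)
    also have "\<dots> = (\<Sum>k<m. if n = k then cos_coeff g n else 0)"
      by (intro sum.cong) (auto simp: cos_coeff_cos a_def)
    finally show ?thesis by (auto simp: sum.delta)
  qed
  have "compact (g' ` {0..pi})" by (intro compact_continuous_image contg') auto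
  then obtain B where B: "\<And>x. x \<in> {0..pi} \<Longrightarrow> \<bar>g' x\<bar> \<le> B"
    by (force simp: bounded_iff dest: compact_imp_bounded)
  have coeff_nonneg: "0 \<le> cos_coeff g' n" for n using nonneg[of n] by (simp add: coeff)
  have "(\<Sum>n<M. cos_coeff g' n) \<le> 2 * pi * B" for M
    using contg' B coeff_nonneg by (rule sum_cos_coeff_le)
  then have "summable (cos_coeff g')"
    using coeff_nonneg by (intro summableI_nonneg_bounded)
  then show ?thesis
    by (rule summable_cong[THEN iffD1, rotated])
       (auto simp: eventually_sequentially coeff nonneg intro!: exI[of _ m])
qed

text \<open>Divides by the squared norms of the cosines on [0, pi]: pi for index 0, pi/2
  otherwise.\<close>

definition cos_series_coeff :: "(real \<Rightarrow> real) \<Rightarrow> nat \<Rightarrow> real" where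
  "cos_series_coeff g n = (if n = 0 then 1 else 2) / pi * cos_coeff g n"

text \<open>The series converges uniformly to a continuous \<open>S\<close> with the same cosine
  coefficients as \<open>g\<close>; completeness identifies the two.\<close>

lemma cos_series_sums:
  assumes g: "continuous_on {0..pi} g" and summ: "summable (\<lambda>n. \<bar>cos_series_coeff g n\<bar>)"
    and x: "x \<in> {0..pi}"
  shows "(\<lambda>n. cos_series_coeff g n * cos (real n * x)) sums g x"
proof -
  define a where "a = cos_series_coeff g"
  define S where "S x = (\<Sum>n. a n * cos (real n * x))" for x
  have bound: "norm (a n * cos (real n * x)) \<le> \<bar>a n\<bar>" for n x
    using mult_left_mono[OF abs_cos_le_one[of "real n * x"] abs_ge_zero[of "a n"]]
    by (simp add: abs_mult)
  have unif: "uniform_limit {0..pi} (\<lambda>N x. \<Sum>n<N. a n * cos (real n * x)) S sequentially"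
    unfolding S_def by (rule Weierstrass_m_test[OF bound]) (use summ in \<open>simp add: a_def\<close>)
  have contS: "continuous_on {0..pi} S"
    by (rule uniform_limit_theorem[OF always_eventually unif]) (intro allI continuous_intros, simp)
  have "cos_coeff S k = cos_coeff g k" for k
  proof -
    have "uniform_limit {0..pi} (\<lambda>N x. (\<Sum>n<N. a n * cos (real n * x)) * cos (real k * x))
        (\<lambda>x. S x * cos (real k * x)) sequentially"
      by (intro uniform_lim_mult unif uniform_limit_const compact_imp_bounded
           compact_continuous_image continuous_intros contS) simp_all
    then have "\<exists>I J. (\<forall>N. ((\<lambda>x. (\<Sum>n<N. a n * cos (real n * x)) * cos (real k * x)) has_integral I N) {0..pi})
      \<and> ((\<lambda>x. S x * cos (real k * x)) has_integral J) {0..pi} \<and> I \<longlonglongrightarrow> J"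
    proof (rule uniform_limit_integral)
      show "continuous_on {0..pi} (\<lambda>x. (\<Sum>n<N. a n * cos (real n * x)) * cos (real k * x))" for N
        by (intro continuous_intros)
    qed (simp, blast)
    then obtain I J where IJ:
      "\<And>N. ((\<lambda>x. (\<Sum>n<N. a n * cos (real n * x)) * cos (real k * x)) has_integral I N) {0..pi}"
      "((\<lambda>x. S x * cos (real k * x)) has_integral J) {0..pi}" "I \<longlonglongrightarrow> J"
      by blast
    \<comment> \<open>By orthogonality a partial sum reaching beyond \<open>k\<close> already has
      the final coefficient, so the sequence is eventually constant.\<close>
    have "I N = cos_coeff g k" if "N > k" for N
    proof -
      have "I N = cos_coeff (\<lambda>x. \<Sum>n<N. a n * cos (real n * x)) k"
        unfolding cos_coeff_def using IJ(1)[of N] by (simp add: integral_unique)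
      also have "\<dots> = (\<Sum>n<N. a n * cos_coeff (\<lambda>x. cos (real n * x)) k)"
        by (subst cos_coeff_sum) (auto intro!: continuous_intros simp: cos_coeff_cmult)
      also have "\<dots> = (\<Sum>n<N. if k = n then cos_coeff g k else 0)"
        by (intro sum.cong) (auto simp: cos_coeff_cos a_def cos_series_coeff_def)
      finally show ?thesis using that by (simp add: sum.delta)
    qed
    then have "I \<longlonglongrightarrow> cos_coeff g k"
      by (intro tendsto_eventually) (auto simp: eventually_sequentially intro!: exI[of _ "Suc k"])
    with IJ(3) have "J = cos_coeff g k" by (rule LIMSEQ_unique)
    with IJ(2) show ?thesis unfolding cos_coeff_def by (simp add: integral_unique)
  qed
  then have "cos_coeff (\<lambda>x. g x - S x) k = 0" for k
    using cos_coeff_diff[OF g contS] by simp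
  then have "g x - S x = 0"
    by (rule cos_coeff_zero_imp_zero[OF continuous_on_diff[OF g contS] _ x])
  moreover have "summable (\<lambda>n. a n * cos (real n * x))"
    by (rule summable_comparison_test'[of "\<lambda>n. \<bar>a n\<bar>" 0, OF _ bound]) (use summ in \<open>simp add: a_def\<close>)
  ultimately show ?thesis unfolding a_def[symmetric] S_def by (simp add: summable_sums)
qed

section \<open>Second differences\<close>

definition second_diff :: "real \<Rightarrow> (real \<Rightarrow> real) \<Rightarrow> real \<Rightarrow> real" where
  "second_diff h f x = f (x + h) - 2 * f x + f (x - h)"

lemma second_diff_funpow_Suc:
  "(second_diff h ^^ Suc K) f x
     = (second_diff h ^^ K) f (x + h) - 2 * (second_diff h ^^ K) f x + (second_diff h ^^ K) f (x - h)"
  unfolding funpow.simps o_apply by (rule second_diff_def)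

text \<open>The function f(x+t) + f(x-t) - 2 f(x) of t vanishes at zero together with its
  derivative, so the increment bound applies twice. The factor 2 counts the two values of f'' in its
  second derivative.\<close>

lemma second_diff_le:
  assumes f: "\<And>y. (f has_real_derivative f' y) (at y)" "\<And>y. (f' has_real_derivative f'' y) (at y)"
    and bound: "\<And>y. \<bar>y\<bar> \<le> R \<Longrightarrow> \<bar>f'' y\<bar> \<le> B" and x: "\<bar>x\<bar> + \<bar>h\<bar> \<le> R"
  shows "\<bar>second_diff h f x\<bar> \<le> 2 * B * h\<^sup>2"
proof -
  have chain: "((\<lambda>t. g (x + t)) has_real_derivative g' (x + t)) (at t)"
    "((\<lambda>t. g (x - t)) has_real_derivative - g' (x - t)) (at t)"
    if "\<And>y. (g has_real_derivative g' y) (at y)" for g g' t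
  proof -
    have "((\<lambda>t. x + t) has_real_derivative 1) (at t)" "((\<lambda>t. x - t) has_real_derivative - 1) (at t)"
      by (rule derivative_eq_intros refl | simp)+
    from DERIV_chain2[OF that this(1)] DERIV_chain2[OF that this(2)] show
      "((\<lambda>t. g (x + t)) has_real_derivative g' (x + t)) (at t)"
      "((\<lambda>t. g (x - t)) has_real_derivative - g' (x - t)) (at t)" by simp_all
  qed
  have B: "0 \<le> B" using order_trans[OF abs_ge_zero bound[of 0]] x by linarith
  have first: "\<bar>f' (x + t) - f' (x - t)\<bar> \<le> 2 * B * \<bar>t\<bar> ^ Suc 0" if "\<bar>t\<bar> \<le> \<bar>h\<bar>" for t
  proof (rule increment_bound_zero[OF _ _ _ that])
    fix s assume s: "\<bar>s\<bar> \<le> \<bar>h\<bar>"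
    show "((\<lambda>t. f' (x + t) - f' (x - t)) has_real_derivative f'' (x + s) - - f'' (x - s)) (at s)"
      by (intro DERIV_diff chain[OF f(2)])
    have "\<bar>f'' (x + s)\<bar> \<le> B" "\<bar>f'' (x - s)\<bar> \<le> B" using x s by (auto intro!: bound)
    then show "\<bar>f'' (x + s) - - f'' (x - s)\<bar> \<le> 2 * B * \<bar>s\<bar> ^ 0" by simp
  qed (use B in auto)
  have "\<bar>f (x + h) + f (x - h) - 2 * f x\<bar> \<le> 2 * B * \<bar>h\<bar> ^ Suc (Suc 0)"
  proof (rule increment_bound_zero[where \<delta> = "\<bar>h\<bar>"])
    fix t assume t: "\<bar>t\<bar> \<le> \<bar>h\<bar>"
    show "((\<lambda>t. f (x + t) + f (x - t) - 2 * f x) has_real_derivative f' (x + t) + - f' (x - t) - 0) (at t)"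
      by (intro DERIV_diff DERIV_add chain[OF f(1)] DERIV_const)
    show "\<bar>f' (x + t) + - f' (x - t) - 0\<bar> \<le> 2 * B * \<bar>t\<bar> ^ Suc 0"
      using first[OF t] by simp
  qed (use B in auto)
  then show ?thesis by (simp add: second_diff_def power2_eq_square algebra_simps)
qed

text \<open>The induction runs over whole chains of derivatives: second differences commute with
  differentiation, so they map a chain to a chain, with bounds on a radius smaller by |h|.\<close>

lemma second_diff_funpow_le:
  assumes "\<And>i y. i < 2 * K \<Longrightarrow> (G i has_real_derivative G (Suc i) y) (at y)"
    and "\<And>y. \<bar>y\<bar> \<le> R \<Longrightarrow> \<bar>G (2 * K) y\<bar> \<le> B" and "\<bar>x\<bar> + real K * \<bar>h\<bar> \<le> R"
  shows "\<bar>(second_diff h ^^ K) (G 0) x\<bar> \<le> 2 ^ K * B * h ^ (2 * K)"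
  using assms
proof (induction K arbitrary: G R B)
  case (Suc K)
  have deriv: "(second_diff h (G i) has_real_derivative second_diff h (G (Suc i)) y) (at y)"
    if i: "i < 2 * K" for i y
  proof -
    have d: "(G i has_real_derivative G (Suc i) y) (at y)" for y using Suc.prems(1)[of i] i by simp
    have "((\<lambda>y. y + h) has_real_derivative 1) (at y)" "((\<lambda>y. y - h) has_real_derivative 1) (at y)"
      by (rule derivative_eq_intros refl | simp)+
    from DERIV_chain2[OF d this(1)] DERIV_chain2[OF d this(2)]
    have "((\<lambda>y. G i (y + h)) has_real_derivative G (Suc i) (y + h)) (at y)"
      "((\<lambda>y. G i (y - h)) has_real_derivative G (Suc i) (y - h)) (at y)" by simp_all
    with d show ?thesis unfolding second_diff_def[abs_def]
      by (intro DERIV_add DERIV_diff DERIV_cmult)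
  qed
  have "\<bar>(second_diff h ^^ K) ((\<lambda>i. second_diff h (G i)) 0) x\<bar> \<le> 2 ^ K * (2 * B * h\<^sup>2) * h ^ (2 * K)"
  proof (rule Suc.IH[of "\<lambda>i. second_diff h (G i)" "R - \<bar>h\<bar>"])
    fix y assume "\<bar>y\<bar> \<le> R - \<bar>h\<bar>"
    then show "\<bar>second_diff h (G (2 * K)) y\<bar> \<le> 2 * B * h\<^sup>2"
      using Suc.prems(1)[of "2 * K"] Suc.prems(1)[of "Suc (2 * K)"] Suc.prems(2)
      by (intro second_diff_le[where f' = "G (Suc (2 * K))" and f'' = "G (Suc (Suc (2 * K)))" and R = R]) auto
  qed (use deriv Suc.prems(3) in \<open>auto simp: algebra_simps\<close>)
  then show ?case by (simp add: funpow_Suc_right power2_eq_square mult_ac del: funpow.simps)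
qed simp

text \<open>Chooses the derivatives as one indexed chain, the form that
  \<open>second_diff_funpow_le\<close> takes.\<close>

lemma Ck_on_derivative_sequence:
  "Ck_on n f UNIV \<Longrightarrow> \<exists>G. G 0 = f \<and> (\<forall>i<n. \<forall>x. (G i has_real_derivative G (Suc i) x) (at x)) \<and>
     continuous_on UNIV (G n)"
proof (induction n arbitrary: f)
  case 0
  then show ?case by (intro exI[of _ "\<lambda>_. f"]) simp
next
  case (Suc n)
  then obtain f' where f': "\<forall>x. (f has_real_derivative f' x) (at x)" "Ck_on n f' UNIV" by auto
  from Suc.IH[OF f'(2)] obtain G where G: "G 0 = f'"
    "\<forall>i<n. \<forall>x. (G i has_real_derivative G (Suc i) x) (at x)" "continuous_on UNIV (G n)" by blast
  show ?case
    using G f'(1) by (intro exI[of _ "case_nat f G"]) (auto split: nat.split simp: less_Suc_eq_0_disj)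
qed

lemma Ck_on_second_diff_funpow_le:
  assumes "Ck_on (2 * K) f UNIV"
  obtains B where "B \<ge> 0" "\<And>h. real K * \<bar>h\<bar> \<le> 1 \<Longrightarrow> \<bar>(second_diff h ^^ K) f 0\<bar> \<le> B * h ^ (2 * K)"
proof -
  obtain G where G: "G 0 = f"
    "\<And>i x. i < 2 * K \<Longrightarrow> (G i has_real_derivative G (Suc i) x) (at x)" "continuous_on UNIV (G (2 * K))"
    using Ck_on_derivative_sequence[OF assms] by blast
  have "compact (G (2 * K) ` {-1..1})"
    by (intro compact_continuous_image continuous_on_subset[OF G(3)]) auto
  then obtain B where B: "\<And>x. x \<in> {-1..1} \<Longrightarrow> \<bar>G (2 * K) x\<bar> \<le> B"
    by (force simp: bounded_iff dest: compact_imp_bounded)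
  have "0 \<le> B" using order_trans[OF abs_ge_zero B[of 0]] by simp
  moreover have "\<bar>(second_diff h ^^ K) (G 0) 0\<bar> \<le> 2 ^ K * B * h ^ (2 * K)" if "real K * \<bar>h\<bar> \<le> 1" for h
    by (rule second_diff_funpow_le[where R = 1]) (use G B that in \<open>auto simp: abs_le_iff\<close>)
  ultimately show ?thesis using that[of "2 ^ K * B"] G(1) by simp
qed

text \<open>Each second difference has total weight 1 + 2 + 1 = 4.\<close>

lemma abs_second_diff_funpow_le:
  assumes "\<And>y. \<bar>y\<bar> \<le> \<bar>x\<bar> + real K * \<bar>h\<bar> \<Longrightarrow> \<bar>r y\<bar> \<le> B"
  shows "\<bar>(second_diff h ^^ K) r x\<bar> \<le> 4 ^ K * B"
  using assms
proof (induction K arbitrary: x)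
  case (Suc K)
  have *: "\<bar>(second_diff h ^^ K) r y\<bar> \<le> 4 ^ K * B" if "\<bar>y\<bar> \<le> \<bar>x\<bar> + \<bar>h\<bar>" for y
    by (intro Suc.IH Suc.prems) (use that in \<open>auto simp: algebra_simps\<close>)
  have "\<bar>(second_diff h ^^ K) r (x + h)\<bar> \<le> 4 ^ K * B" "\<bar>(second_diff h ^^ K) r x\<bar> \<le> 4 ^ K * B"
    "\<bar>(second_diff h ^^ K) r (x - h)\<bar> \<le> 4 ^ K * B"
    by (rule *; simp)+
  then show ?case unfolding second_diff_funpow_Suc by simp
qed simp

text \<open>An iterated second difference sees only points within K|h|. This matters because a
  function is compared with its cosine series on [-pi, pi] only.\<close>

lemma second_diff_funpow_cong:
  assumes "\<And>y. \<bar>y\<bar> \<le> \<bar>x\<bar> + real K * \<bar>h\<bar> \<Longrightarrow> f y = g y"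
  shows "(second_diff h ^^ K) f x = (second_diff h ^^ K) g x"
  using assms
proof (induction K arbitrary: x)
  case (Suc K)
  have *: "(second_diff h ^^ K) f y = (second_diff h ^^ K) g y" if "\<bar>y\<bar> \<le> \<bar>x\<bar> + \<bar>h\<bar>" for y
    by (intro Suc.IH Suc.prems) (use that in \<open>auto simp: algebra_simps\<close>)
  show ?case unfolding second_diff_funpow_Suc by (simp add: *)
qed simp

lemma second_diff_funpow_add:
  "(second_diff h ^^ K) (\<lambda>x. f x + g x) x = (second_diff h ^^ K) f x + (second_diff h ^^ K) g x"
  by (induction K arbitrary: x) (simp_all add: second_diff_funpow_Suc del: funpow.simps(2))

lemma second_diff_funpow_sums:
  assumes "\<And>x. (\<lambda>n. f n x) sums S x"
  shows "(\<lambda>n. (second_diff h ^^ K) (f n) x) sums (second_diff h ^^ K) S x"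
proof (induction K arbitrary: x)
  case (Suc K)
  show ?case unfolding second_diff_funpow_Suc by (intro sums_add sums_diff sums_mult Suc)
qed (simp add: assms)

text \<open>Cosines are eigenfunctions of \<open>second_diff h\<close>. The eigenvalue -(2 - 2
  cos(ch)) has a fixed sign, so at zero, up to (-1)^K, each coefficient gets a nonnegative
  weight.\<close>

lemma second_diff_funpow_cos:
  "(second_diff h ^^ K) (\<lambda>x. a * cos (c * x)) x = (- 1) ^ K * (2 - 2 * cos (c * h)) ^ K * (a * cos (c * x))"
proof (induction K arbitrary: x)
  case (Suc K)
  have "cos (c * (x + h)) + cos (c * (x - h)) = 2 * cos (c * x) * cos (c * h)"
    by (simp add: algebra_simps cos_add cos_diff)
  then have *: "cos (c * (x + h)) = 2 * cos (c * x) * cos (c * h) - cos (c * (x - h))" by simp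
  show ?case unfolding second_diff_funpow_Suc Suc * by (simp add: algebra_simps)
qed simp

section \<open>Positive definite kernels on complex spheres\<close>

text \<open>Weights and values are complex because the kernels get multiplied by powers of the
  Hermitian inner product. The real part is taken since no symmetry of \<open>G\<close> is assumed
  and the double sum need not be real.\<close>

definition cpsd :: "nat \<Rightarrow> (complex \<Rightarrow> complex) \<Rightarrow> bool" where
  "cpsd N G \<longleftrightarrow> (\<forall>n (x :: nat \<Rightarrow> nat \<Rightarrow> complex) (c :: nat \<Rightarrow> complex).
     (\<forall>i<n. (\<Sum>l<N. (cmod (x i l))\<^sup>2) = 1) \<longrightarrow>
     0 \<le> Re (\<Sum>i<n. \<Sum>j<n. c i * cnj (c j) * G (\<Sum>l<N. x i l * cnj (x j l))))"

lemma cpsdD: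
  fixes n :: nat
  shows "cpsd N G \<Longrightarrow> (\<And>i. i < n \<Longrightarrow> (\<Sum>l<N. (cmod (x i l))\<^sup>2) = 1) \<Longrightarrow>
     0 \<le> Re (\<Sum>i<n. \<Sum>j<n. c i * cnj (c j) * G (\<Sum>l<N. x i l * cnj (x j l)))"
  unfolding cpsd_def by (drule spec[of _ n], drule spec[of _ x], drule spec[of _ c], erule mp, simp)

lemma cpsd_finite_family:
  assumes "cpsd N G" "finite I" "\<And>i. i \<in> I \<Longrightarrow> (\<Sum>l<N. (cmod (x i l))\<^sup>2) = 1"
  shows "0 \<le> Re (\<Sum>i\<in>I. \<Sum>j\<in>I. c i * cnj (c j) * G (\<Sum>l<N. x i l * cnj (x j l)))"
proof -
  obtain h where h: "bij_betw h {..<card I} I"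
    using ex_bij_betw_nat_finite[OF assms(2)] by (auto simp: atLeast0LessThan)
  have nonneg: "0 \<le> Re (\<Sum>i<card I. \<Sum>j<card I. c (h i) * cnj (c (h j)) * G (\<Sum>l<N. x (h i) l * cnj (x (h j) l)))"
    by (rule cpsdD[OF assms(1), where x = "\<lambda>i. x (h i)" and c = "\<lambda>i. c (h i)"], rule assms(3))
       (use bij_betwE[OF h] in simp)
  have "(\<Sum>i<card I. \<Sum>j<card I. c (h i) * cnj (c (h j)) * G (\<Sum>l<N. x (h i) l * cnj (x (h j) l)))
      = (\<Sum>i<card I. \<Sum>j\<in>I. c (h i) * cnj (c j) * G (\<Sum>l<N. x (h i) l * cnj (x j l)))"
    by (intro sum.cong refl sum.reindex_bij_betw[OF h])
  also have "\<dots> = (\<Sum>i\<in>I. \<Sum>j\<in>I. c i * cnj (c j) * G (\<Sum>l<N. x i l * cnj (x j l)))"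
    by (rule sum.reindex_bij_betw[OF h])
  finally show ?thesis by (rule subst[where P = "\<lambda>z. 0 \<le> Re z"]) (rule nonneg)
qed

text \<open>The instance of Schur's product theorem that is used: the inner product is a sum over
  coordinates of rank-one kernels, whose factors are absorbed into the weights
  \<open>c\<close>.\<close>

lemma cpsd_mult_ident:
  assumes "cpsd N G"
  shows "cpsd N (\<lambda>z. G z * z)"
  unfolding cpsd_def
proof (intro allI impI)
  fix n :: nat and x :: "nat \<Rightarrow> nat \<Rightarrow> complex" and c :: "nat \<Rightarrow> complex"
  assume x: "\<forall>i<n. (\<Sum>l<N. (cmod (x i l))\<^sup>2) = 1"
  define s where "s i j = (\<Sum>l<N. x i l * cnj (x j l))" for i j
  have expand: "u * cnj v * (z * s i j) = (\<Sum>l<N. (u * x i l) * cnj (v * x j l) * z)" for u v z i j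
    by (simp add: s_def sum_distrib_left mult_ac)
  have "(\<Sum>i<n. \<Sum>j<n. c i * cnj (c j) * (G (s i j) * s i j))
      = (\<Sum>i<n. \<Sum>j<n. \<Sum>l<N. (c i * x i l) * cnj (c j * x j l) * G (s i j))"
    by (simp only: expand)
  also have "\<dots> = (\<Sum>i<n. \<Sum>l<N. \<Sum>j<n. (c i * x i l) * cnj (c j * x j l) * G (s i j))"
    by (rule sum.cong[OF refl], rule sum.swap)
  also have "\<dots> = (\<Sum>l<N. \<Sum>i<n. \<Sum>j<n. (c i * x i l) * cnj (c j * x j l) * G (s i j))"
    by (rule sum.swap)
  finally have eq: "(\<Sum>i<n. \<Sum>j<n. c i * cnj (c j) * (G (s i j) * s i j))
      = (\<Sum>l<N. \<Sum>i<n. \<Sum>j<n. (c i * x i l) * cnj (c j * x j l) * G (s i j))" .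
  have "0 \<le> Re (\<Sum>i<n. \<Sum>j<n. (c i * x i l) * cnj (c j * x j l) * G (s i j))" for l
    unfolding s_def by (rule cpsdD[OF assms, where c = "\<lambda>i. c i * x i l"]) (simp add: x)
  then have "0 \<le> Re (\<Sum>i<n. \<Sum>j<n. c i * cnj (c j) * (G (s i j) * s i j))"
    unfolding eq Re_sum[of _ "{..<N}"] by (rule sum_nonneg)
  then show "0 \<le> Re (\<Sum>i<n. \<Sum>j<n. c i * cnj (c j) *
      (G (\<Sum>l<N. x i l * cnj (x j l)) * (\<Sum>l<N. x i l * cnj (x j l))))"
    unfolding s_def .
qed

lemma cpsd_mult_power: "cpsd N G \<Longrightarrow> cpsd N (\<lambda>z. G z * z ^ n)"
proof (induction n)
  case (Suc n)
  then have "cpsd N (\<lambda>z. (G z * z ^ n) * z)" by (intro cpsd_mult_ident)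
  then show ?case by (simp add: mult_ac)
qed simp

text \<open>Integrates out the last complex coordinate against the discrete measure with weights
  \<open>q\<close> on the points \<open>(\<alpha> \<kappa> \<cdot> x, \<beta> \<kappa>)\<close>.\<close>

definition kernel_avg ::
    "'k set \<Rightarrow> ('k \<Rightarrow> real) \<Rightarrow> ('k \<Rightarrow> real) \<Rightarrow> ('k \<Rightarrow> complex) \<Rightarrow> (complex \<Rightarrow> complex) \<Rightarrow> complex \<Rightarrow> complex" where
  "kernel_avg K q \<alpha> \<beta> G w = (\<Sum>\<kappa>\<in>K. \<Sum>\<kappa>'\<in>K. of_real (q \<kappa> * q \<kappa>') *
     G (of_real (\<alpha> \<kappa> * \<alpha> \<kappa>') * w + \<beta> \<kappa> * cnj (\<beta> \<kappa>')))"

text \<open>The points (\<alpha> x, \<beta>), one for each pair of a given point and an index in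
  \<open>K\<close>, lie on the larger sphere. Testing \<open>G\<close> there with product weights
  gives the quadratic form of the averaged kernel.\<close>

lemma cpsd_kernel_avg:
  assumes G: "cpsd (Suc N) G" and K: "finite K"
    and unit: "\<And>\<kappa>. \<kappa> \<in> K \<Longrightarrow> (\<alpha> \<kappa>)\<^sup>2 + (cmod (\<beta> \<kappa>))\<^sup>2 = 1"
  shows "cpsd N (kernel_avg K q \<alpha> \<beta> G)"
  unfolding cpsd_def
proof (intro allI impI)
  fix n :: nat and x :: "nat \<Rightarrow> nat \<Rightarrow> complex" and c :: "nat \<Rightarrow> complex"
  assume x: "\<forall>i<n. (\<Sum>l<N. (cmod (x i l))\<^sup>2) = 1"
  define y where "y p l = (if l < N then of_real (\<alpha> (snd p)) * x (fst p) l else \<beta> (snd p))" for p l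
  define d where "d p = c (fst p) * of_real (q (snd p))" for p
  have inner: "(\<Sum>l<Suc N. y p l * cnj (y p' l))
      = of_real (\<alpha> (snd p) * \<alpha> (snd p')) * (\<Sum>l<N. x (fst p) l * cnj (x (fst p') l))
        + \<beta> (snd p) * cnj (\<beta> (snd p'))" for p p'
    by (simp add: y_def sum_distrib_left mult_ac)
  have unit_y: "(\<Sum>l<Suc N. (cmod (y p l))\<^sup>2) = 1" if "p \<in> {..<n} \<times> K" for p
  proof -
    have "(\<Sum>l<Suc N. (cmod (y p l))\<^sup>2)
        = (\<alpha> (snd p))\<^sup>2 * (\<Sum>l<N. (cmod (x (fst p) l))\<^sup>2) + (cmod (\<beta> (snd p)))\<^sup>2"
      by (simp add: y_def norm_mult power_mult_distrib sum_distrib_left)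
    moreover have "(\<Sum>l<N. (cmod (x (fst p) l))\<^sup>2) = 1" "snd p \<in> K" using x that by auto
    ultimately show ?thesis using unit[of "snd p"] by simp
  qed
  have nonneg: "0 \<le> Re (\<Sum>p\<in>{..<n} \<times> K. \<Sum>p'\<in>{..<n} \<times> K. d p * cnj (d p') * G (\<Sum>l<Suc N. y p l * cnj (y p' l)))"
    by (rule cpsd_finite_family[OF G _ unit_y]) (simp_all add: K)
  have "(\<Sum>p\<in>{..<n} \<times> K. \<Sum>p'\<in>{..<n} \<times> K. d p * cnj (d p') * G (\<Sum>l<Suc N. y p l * cnj (y p' l)))
      = (\<Sum>i<n. \<Sum>\<kappa>\<in>K. \<Sum>j<n. \<Sum>\<kappa>'\<in>K. c i * cnj (c j) * (of_real (q \<kappa> * q \<kappa>') *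
          G (of_real (\<alpha> \<kappa> * \<alpha> \<kappa>') * (\<Sum>l<N. x i l * cnj (x j l)) + \<beta> \<kappa> * cnj (\<beta> \<kappa>'))))"
    by (simp only: inner d_def sum.cartesian_product' fst_conv snd_conv) (simp add: mult_ac)
  also have "\<dots> = (\<Sum>i<n. \<Sum>j<n. \<Sum>\<kappa>\<in>K. \<Sum>\<kappa>'\<in>K. c i * cnj (c j) * (of_real (q \<kappa> * q \<kappa>') *
          G (of_real (\<alpha> \<kappa> * \<alpha> \<kappa>') * (\<Sum>l<N. x i l * cnj (x j l)) + \<beta> \<kappa> * cnj (\<beta> \<kappa>'))))"
    by (rule sum.cong[OF refl], rule sum.swap)
  also have "\<dots> = (\<Sum>i<n. \<Sum>j<n. c i * cnj (c j) * kernel_avg K q \<alpha> \<beta> G (\<Sum>l<N. x i l * cnj (x j l)))"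
    by (simp only: kernel_avg_def sum_distrib_left)
  finally show "0 \<le> Re (\<Sum>i<n. \<Sum>j<n. c i * cnj (c j) * kernel_avg K q \<alpha> \<beta> G (\<Sum>l<N. x i l * cnj (x j l)))"
    by (rule subst[where P = "\<lambda>z. 0 \<le> Re z"]) (rule nonneg)
qed

section \<open>Linearity, size and monomials of averaged kernels\<close>

lemma kernel_avg_sum:
  fixes a :: "'b \<Rightarrow> complex"
  shows "kernel_avg K q \<alpha> \<beta> (\<lambda>z. \<Sum>i\<in>I. a i * G i z) w = (\<Sum>i\<in>I. a i * kernel_avg K q \<alpha> \<beta> (G i) w)"
proof -
  have pull: "u * (\<Sum>i\<in>I. a i * X i) = (\<Sum>i\<in>I. a i * (u * X i))" for u and X :: "'b \<Rightarrow> complex"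
    by (simp add: sum_distrib_left mult.left_commute)
  have "kernel_avg K q \<alpha> \<beta> (\<lambda>z. \<Sum>i\<in>I. a i * G i z) w
      = (\<Sum>\<kappa>\<in>K. \<Sum>\<kappa>'\<in>K. \<Sum>i\<in>I. a i * (of_real (q \<kappa> * q \<kappa>') *
          G i (of_real (\<alpha> \<kappa> * \<alpha> \<kappa>') * w + \<beta> \<kappa> * cnj (\<beta> \<kappa>'))))"
    by (simp only: kernel_avg_def pull)
  also have "\<dots> = (\<Sum>\<kappa>\<in>K. \<Sum>i\<in>I. \<Sum>\<kappa>'\<in>K. a i * (of_real (q \<kappa> * q \<kappa>') *
          G i (of_real (\<alpha> \<kappa> * \<alpha> \<kappa>') * w + \<beta> \<kappa> * cnj (\<beta> \<kappa>'))))"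
    by (rule sum.cong[OF refl], rule sum.swap)
  also have "\<dots> = (\<Sum>i\<in>I. \<Sum>\<kappa>\<in>K. \<Sum>\<kappa>'\<in>K. a i * (of_real (q \<kappa> * q \<kappa>') *
          G i (of_real (\<alpha> \<kappa> * \<alpha> \<kappa>') * w + \<beta> \<kappa> * cnj (\<beta> \<kappa>'))))"
    by (rule sum.swap)
  finally show ?thesis by (simp only: kernel_avg_def sum_distrib_left)
qed

text \<open>The arguments of \<open>G\<close> stay in the unit disc by Cauchy-Schwarz, obtained here
  from 2st \<le> s^2 + t^2.\<close>

lemma cmod_kernel_avg_le:
  assumes G: "\<And>z. cmod z \<le> 1 \<Longrightarrow> cmod (G z) \<le> B" and w: "cmod w \<le> 1"
    and q: "\<And>\<kappa>. \<kappa> \<in> K \<Longrightarrow> 0 \<le> q \<kappa>"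
    and unit: "\<And>\<kappa>. \<kappa> \<in> K \<Longrightarrow> (\<alpha> \<kappa>)\<^sup>2 + (cmod (\<beta> \<kappa>))\<^sup>2 = 1"
  shows "cmod (kernel_avg K q \<alpha> \<beta> G w) \<le> B * (sum q K)\<^sup>2"
proof -
  have "cmod (kernel_avg K q \<alpha> \<beta> G w) \<le> (\<Sum>\<kappa>\<in>K. \<Sum>\<kappa>'\<in>K. q \<kappa> * q \<kappa>' * B)"
    unfolding kernel_avg_def
  proof (intro sum_norm_le)
    fix \<kappa> \<kappa>' assume K: "\<kappa> \<in> K" "\<kappa>' \<in> K"
    have "cmod (of_real (\<alpha> \<kappa> * \<alpha> \<kappa>') * w + \<beta> \<kappa> * cnj (\<beta> \<kappa>'))
        \<le> \<bar>\<alpha> \<kappa>\<bar> * \<bar>\<alpha> \<kappa>'\<bar> * cmod w + cmod (\<beta> \<kappa>) * cmod (\<beta> \<kappa>')"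
      by (rule norm_triangle_le) (simp add: norm_mult abs_mult)
    also have "\<dots> \<le> \<bar>\<alpha> \<kappa>\<bar> * \<bar>\<alpha> \<kappa>'\<bar> + cmod (\<beta> \<kappa>) * cmod (\<beta> \<kappa>')"
      using w by (simp add: mult_left_le)
    also have "\<dots> \<le> 1"
      using unit[OF K(1)] unit[OF K(2)] sum_squares_bound[of "\<bar>\<alpha> \<kappa>\<bar>" "\<bar>\<alpha> \<kappa>'\<bar>"]
        sum_squares_bound[of "cmod (\<beta> \<kappa>)" "cmod (\<beta> \<kappa>')"] by simp
    finally have "cmod (G (of_real (\<alpha> \<kappa> * \<alpha> \<kappa>') * w + \<beta> \<kappa> * cnj (\<beta> \<kappa>'))) \<le> B" by (rule G)
    then show "cmod (of_real (q \<kappa> * q \<kappa>') * G (of_real (\<alpha> \<kappa> * \<alpha> \<kappa>') * w + \<beta> \<kappa> * cnj (\<beta> \<kappa>'))) \<le> q \<kappa> * q \<kappa>' * B"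
      using q[OF K(1)] q[OF K(2)] by (simp add: norm_mult mult_left_mono)
  qed
  also have "\<dots> = B * (sum q K)\<^sup>2"
    by (simp add: power2_eq_square sum_product sum_distrib_left mult_ac)
  finally show ?thesis .
qed

text \<open>In the binomial expansion the two indices separate: each term contains a function of
  \<kappa> times the conjugate of the same function of \<kappa>', so the double sum becomes a
  squared modulus.\<close>

lemma kernel_avg_moment:
  "kernel_avg K q \<alpha> \<beta> (\<lambda>z. z ^ a * cnj z ^ b) w =
     (\<Sum>i\<le>a. \<Sum>j\<le>b. of_nat (a choose i) * of_nat (b choose j) *
        of_real ((cmod (\<Sum>\<kappa>\<in>K. of_real (q \<kappa> * \<alpha> \<kappa> ^ (a - i + (b - j))) * \<beta> \<kappa> ^ i * cnj (\<beta> \<kappa>) ^ j))\<^sup>2)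
        * (w ^ (a - i) * cnj w ^ (b - j)))"
proof -
  define F where "F i j \<kappa> = of_real (q \<kappa> * \<alpha> \<kappa> ^ (a - i + (b - j))) * \<beta> \<kappa> ^ i * cnj (\<beta> \<kappa>) ^ j" for i j \<kappa>
  have expand: "of_real (q \<kappa> * q \<kappa>') * ((of_real (\<alpha> \<kappa> * \<alpha> \<kappa>') * w + \<beta> \<kappa> * cnj (\<beta> \<kappa>')) ^ a
      * cnj (of_real (\<alpha> \<kappa> * \<alpha> \<kappa>') * w + \<beta> \<kappa> * cnj (\<beta> \<kappa>')) ^ b)
    = (\<Sum>i\<le>a. \<Sum>j\<le>b. of_nat (a choose i) * of_nat (b choose j) * (w ^ (a - i) * cnj w ^ (b - j))
        * (F i j \<kappa> * cnj (F i j \<kappa>')))" for \<kappa> \<kappa>'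
  proof -
    have "(of_real (\<alpha> \<kappa> * \<alpha> \<kappa>') * w + \<beta> \<kappa> * cnj (\<beta> \<kappa>')) ^ a
        = (\<Sum>i\<le>a. of_nat (a choose i) * (\<beta> \<kappa> * cnj (\<beta> \<kappa>')) ^ i * (of_real (\<alpha> \<kappa> * \<alpha> \<kappa>') * w) ^ (a - i))"
      unfolding binomial_ring[symmetric] by (simp add: add.commute)
    moreover have "cnj (of_real (\<alpha> \<kappa> * \<alpha> \<kappa>') * w + \<beta> \<kappa> * cnj (\<beta> \<kappa>')) ^ b
        = (\<Sum>j\<le>b. of_nat (b choose j) * (cnj (\<beta> \<kappa>) * \<beta> \<kappa>') ^ j * (of_real (\<alpha> \<kappa> * \<alpha> \<kappa>') * cnj w) ^ (b - j))"
      unfolding binomial_ring[symmetric] by (simp add: add.commute)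
    ultimately show ?thesis
      unfolding F_def
      by (simp only:, subst sum_product, simp only: sum_distrib_left, intro sum.cong refl)
         (simp (no_asm) add: power_mult_distrib power_add mult_ac)
  qed
  have "kernel_avg K q \<alpha> \<beta> (\<lambda>z. z ^ a * cnj z ^ b) w
      = (\<Sum>\<kappa>\<in>K. \<Sum>\<kappa>'\<in>K. \<Sum>i\<le>a. \<Sum>j\<le>b. of_nat (a choose i) * of_nat (b choose j) * (w ^ (a - i) * cnj w ^ (b - j))
        * (F i j \<kappa> * cnj (F i j \<kappa>')))"
    by (simp only: kernel_avg_def expand)
  also have "\<dots> = (\<Sum>\<kappa>\<in>K. \<Sum>i\<le>a. \<Sum>\<kappa>'\<in>K. \<Sum>j\<le>b. of_nat (a choose i) * of_nat (b choose j) * (w ^ (a - i) * cnj w ^ (b - j))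
        * (F i j \<kappa> * cnj (F i j \<kappa>')))"
    by (rule sum.cong[OF refl], rule sum.swap)
  also have "\<dots> = (\<Sum>i\<le>a. \<Sum>\<kappa>\<in>K. \<Sum>j\<le>b. \<Sum>\<kappa>'\<in>K. of_nat (a choose i) * of_nat (b choose j) * (w ^ (a - i) * cnj w ^ (b - j))
        * (F i j \<kappa> * cnj (F i j \<kappa>')))"
    by (rule trans[OF sum.swap], rule sum.cong[OF refl], rule sum.cong[OF refl], rule sum.swap)
  also have "\<dots> = (\<Sum>i\<le>a. \<Sum>j\<le>b. \<Sum>\<kappa>\<in>K. \<Sum>\<kappa>'\<in>K. of_nat (a choose i) * of_nat (b choose j) * (w ^ (a - i) * cnj w ^ (b - j))
        * (F i j \<kappa> * cnj (F i j \<kappa>')))"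
    by (rule sum.cong[OF refl], rule sum.swap)
  also have "\<dots> = (\<Sum>i\<le>a. \<Sum>j\<le>b. of_nat (a choose i) * of_nat (b choose j) * (w ^ (a - i) * cnj w ^ (b - j))
        * (sum (F i j) K * cnj (sum (F i j) K)))"
    unfolding cnj_sum sum_product unfolding sum_distrib_left ..
  also have "\<dots> = (\<Sum>i\<le>a. \<Sum>j\<le>b. of_nat (a choose i) * of_nat (b choose j) *
        of_real ((cmod (sum (F i j) K))\<^sup>2) * (w ^ (a - i) * cnj w ^ (b - j)))"
    unfolding complex_norm_square by (simp only: mult_ac)
  finally show ?thesis unfolding F_def .
qed

text \<open>A geometric sum whose ratio is 1 only for i = j, because |i - j| < R. Angular averages
  on the grid are therefore exact for large \<open>R\<close>, and only the radial sums need a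
  limit.\<close>

lemma sum_roots_of_unity:
  assumes "i + j < R"
  shows "(\<Sum>s<R. cis (2 * pi * real s / real R) ^ i * cnj (cis (2 * pi * real s / real R)) ^ j)
    = (if i = j then of_nat R else 0)"
proof -
  define z where "z = cis (2 * pi * (real i - real j) / real R)"
  have R: "real R > 0" using assms by simp
  have "cis (2 * pi * real s / real R) ^ i * cnj (cis (2 * pi * real s / real R)) ^ j = z ^ s" for s
  proof -
    have "cis t ^ i * cnj (cis t) ^ j = cis (real i * t + real j * (- t))" for t
      by (simp add: cis_cnj Complex.DeMoivre cis_mult)
    moreover have "real i * (2 * pi * real s / real R) + real j * (- (2 * pi * real s / real R))
        = real s * (2 * pi * (real i - real j) / real R)" using R by (simp add: field_simps)
    ultimately show ?thesis unfolding z_def Complex.DeMoivre by metis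
  qed
  then have eq: "(\<Sum>s<R. cis (2 * pi * real s / real R) ^ i * cnj (cis (2 * pi * real s / real R)) ^ j)
    = (\<Sum>s<R. z ^ s)" by simp
  show ?thesis
  proof (cases "i = j")
    case False
    have "z ^ R = cis (2 * pi * of_int (int i - int j))"
      unfolding z_def Complex.DeMoivre using R by simp
    also have "\<dots> = 1" by (rule cis_multiple_2pi) auto
    finally have "z ^ R = 1" .
    moreover have "z \<noteq> 1"
    proof
      assume "z = 1"
      then have "cos (2 * pi * (real i - real j) / real R) = 1" by (simp add: z_def complex_eq_iff)
      then obtain k :: int where "2 * pi * (real i - real j) / real R = of_int k * 2 * pi"
        unfolding cos_one_2pi_int by auto
      then have "(2 * pi) * (real i - real j) = (2 * pi) * (of_int k * real R)"
        using R by (simp add: field_simps)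
      then have "real i - real j = of_int k * real R" by (subst (asm) mult_left_cancel) auto
      then have k: "int i - int j = k * int R"
        by (metis of_int_diff of_int_mult of_int_of_nat_eq of_int_eq_iff)
      with False have "k \<noteq> 0" by auto
      then have "int R \<le> \<bar>k\<bar> * int R" using R by (simp add: mult_le_cancel_right1)
      also have "\<dots> = \<bar>int i - int j\<bar>" unfolding k by (simp add: abs_mult)
      also have "\<dots> < int R" using assms by linarith
      finally show False by simp
    qed
    ultimately show ?thesis using False unfolding eq by (simp add: geometric_sum)
  next
    case True
    then have "z = 1" by (simp add: z_def)
    then show ?thesis using True unfolding eq by simp
  qed
qed


text \<open>The last coordinate of a uniformly distributed point of the unit sphere in \<open>\<complex>\<^sup>m\<^sup>+\<^sup>2\<close> is
  \<open>sqrt u * cis t\<close> with \<open>u\<close> of density \<open>(m + 1) * (1 - u) ^ m\<close> and \<open>t\<close> uniform.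
  An index \<open>(r, s)\<close> stands for \<open>u = r / R\<close> and \<open>t = 2 * pi * s / R\<close>.\<close>

definition sphere_weight :: "nat \<Rightarrow> nat \<Rightarrow> nat \<times> nat \<Rightarrow> real" where
  "sphere_weight m R = (\<lambda>(r, s). real (Suc m) * (1 - real r / real R) ^ m / (real R)\<^sup>2)"

definition sphere_scale :: "nat \<Rightarrow> nat \<times> nat \<Rightarrow> real" where
  "sphere_scale R = (\<lambda>(r, s). sqrt (1 - real r / real R))"

definition sphere_coord :: "nat \<Rightarrow> nat \<times> nat \<Rightarrow> complex" where
  "sphere_coord R = (\<lambda>(r, s). of_real (sqrt (real r / real R)) * cis (2 * pi * real s / real R))"

text \<open>A discretised mean of G(<x,y>) over independent points x, y of the unit sphere of
  C^(m+1). Each step removes the last coordinate of both points. In C^1 the points are roots of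
  unity and no inner product is left over, hence scale 0 and argument 0.\<close>

fun sphere_avg :: "nat \<Rightarrow> nat \<Rightarrow> (complex \<Rightarrow> complex) \<Rightarrow> complex" where
  "sphere_avg R 0 G = kernel_avg {..<R} (\<lambda>_. 1 / real R) (\<lambda>_. 0)
     (\<lambda>s. cis (2 * pi * real s / real R)) G 0"
| "sphere_avg R (Suc m) G = sphere_avg R m
     (kernel_avg ({..<R} \<times> {..<R}) (sphere_weight m R) (sphere_scale R) (sphere_coord R) G)"

lemma sphere_weight_coord:
  assumes "\<kappa> \<in> {..<R} \<times> {..<R}"
  shows "0 \<le> sphere_weight m R \<kappa>" "(sphere_scale R \<kappa>)\<^sup>2 + (cmod (sphere_coord R \<kappa>))\<^sup>2 = 1"
  using assms
  by (auto simp: sphere_weight_def sphere_scale_def sphere_coord_def norm_mult divide_le_eq_1)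

lemma sphere_avg_nonneg: "cpsd (Suc m) G \<Longrightarrow> 0 \<le> Re (sphere_avg R m G)"
proof (induction m arbitrary: G)
  case 0
  have "0 \<le> Re (\<Sum>s<R. \<Sum>s'<R. of_real (1 / real R) * cnj (of_real (1 / real R)) *
      G (\<Sum>l<Suc 0. cis (2 * pi * real s / real R) * cnj (cis (2 * pi * real s' / real R))))"
    by (rule cpsd_finite_family[OF 0]) auto
  then show ?case by (simp add: kernel_avg_def)
next
  case (Suc m)
  have "cpsd (Suc m) (kernel_avg ({..<R} \<times> {..<R}) (sphere_weight m R) (sphere_scale R) (sphere_coord R) G)"
    by (rule cpsd_kernel_avg[OF Suc.prems]) (simp, rule sphere_weight_coord)
  then show ?case by (simp add: Suc.IH)
qed

lemma sphere_avg_sum: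
  "sphere_avg R m (\<lambda>z. \<Sum>i\<in>I. a i * G i z) = (\<Sum>i\<in>I. a i * sphere_avg R m (G i))"
  by (induction m arbitrary: G) (simp_all add: kernel_avg_sum[abs_def])

lemma sphere_avg_cmult: "sphere_avg R m (\<lambda>z. c * G z) = c * sphere_avg R m G"
  using sphere_avg_sum[of R m "\<lambda>_. c" "\<lambda>_. G" "{()}"] by simp

lemma sphere_avg_diff: "sphere_avg R m (\<lambda>z. G z - H z) = sphere_avg R m G - sphere_avg R m H"
  using sphere_avg_sum[of R m "\<lambda>i. if i then 1 else - 1" "\<lambda>i. if i then G else H" "UNIV"]
  by (simp add: UNIV_bool)

text \<open>The total mass is kept as the average of the constant 1, because the discrete weights
  are normalised only in the limit.\<close>

lemma cmod_sphere_avg_le: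
  assumes "\<And>z. cmod z \<le> 1 \<Longrightarrow> cmod (G z) \<le> B"
  shows "cmod (sphere_avg R m G) \<le> B * Re (sphere_avg R m (\<lambda>_. 1))"
  using assms
proof (induction m arbitrary: G B)
  case 0
  have "cmod (sphere_avg R 0 G) \<le> B * (\<Sum>s<R. 1 / real R)\<^sup>2"
    unfolding sphere_avg.simps by (rule cmod_kernel_avg_le) (use 0 in auto)
  also have "(\<Sum>s<R. 1 / real R)\<^sup>2 = Re (sphere_avg R 0 (\<lambda>_. 1))"
    by (simp add: kernel_avg_def power2_eq_square sum_product)
  finally show ?case .
next
  case (Suc m)
  define K where "K = {..<R} \<times> {..<R}"
  define Q where "Q = (sum (sphere_weight m R) K)\<^sup>2"
  have "cmod (sphere_avg R m (kernel_avg K (sphere_weight m R) (sphere_scale R) (sphere_coord R) G))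
      \<le> B * Q * Re (sphere_avg R m (\<lambda>_. 1))"
  proof (rule Suc.IH)
    fix w :: complex assume w: "cmod w \<le> 1"
    show "cmod (kernel_avg K (sphere_weight m R) (sphere_scale R) (sphere_coord R) G w) \<le> B * Q"
      unfolding Q_def by (rule cmod_kernel_avg_le[OF Suc.prems w]) (use sphere_weight_coord in \<open>simp_all add: K_def\<close>)
  qed
  moreover have "kernel_avg K (sphere_weight m R) (sphere_scale R) (sphere_coord R) (\<lambda>_. 1) = (\<lambda>w. of_real Q * 1)"
    by (simp add: kernel_avg_def Q_def power2_eq_square sum_product fun_eq_iff)
  ultimately show ?case unfolding sphere_avg.simps K_def[symmetric]
    by (simp only: sphere_avg_cmult) (simp add: mult.assoc)
qed

text \<open>Telescoping: the increment from R^(b+1) to (R+1)^(b+1) lies between (b+1) R^b and (b+1)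
  (R+1)^b.\<close>

lemma tendsto_power_riemann_sum:
  "(\<lambda>R. (\<Sum>r<R. (real r / real R) ^ b) / real R) \<longlonglongrightarrow> 1 / real (Suc b)"
proof -
  define P where "P R = (\<Sum>r<R. real r ^ b)" for R
  have diff: "real (Suc R) ^ Suc b - real R ^ Suc b = (\<Sum>p<Suc b. real (Suc R) ^ p * real R ^ (b - p))" for R
    unfolding diff_power_eq_sum by simp
  have power_split: "x ^ p * x ^ (b - p) = x ^ b" if "p < Suc b" for x :: real and p
    using that by (simp flip: power_add)
  have lower: "real (Suc b) * P R \<le> real R ^ Suc b" for R
  proof (induction R)
    case (Suc R)
    have "real (Suc b) * real R ^ b = (\<Sum>p<Suc b. real R ^ p * real R ^ (b - p))"
      by (simp add: power_split del: sum.lessThan_Suc)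
    also have "\<dots> \<le> real (Suc R) ^ Suc b - real R ^ Suc b"
      unfolding diff by (intro sum_mono mult_right_mono power_mono) auto
    finally show ?case using Suc by (simp add: P_def distrib_left)
  qed (simp add: P_def)
  have upper: "real R ^ Suc b \<le> real (Suc b) * P (Suc R)" for R
  proof (induction R)
    case (Suc R)
    have "real (Suc R) ^ Suc b - real R ^ Suc b \<le> (\<Sum>p<Suc b. real (Suc R) ^ p * real (Suc R) ^ (b - p))"
      unfolding diff by (intro sum_mono mult_left_mono power_mono) auto
    also have "\<dots> = real (Suc b) * real (Suc R) ^ b"
      by (simp add: power_split del: sum.lessThan_Suc of_nat_Suc)
    finally show ?case using Suc by (simp add: P_def distrib_left)
  qed (simp add: P_def)
  have eq: "(\<Sum>r<R. (real r / real R) ^ b) / real R = P R / real R ^ Suc b" for R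
    by (simp add: P_def power_divide sum_divide_distrib mult.commute)
  have le: "P R / real R ^ Suc b \<le> 1 / real (Suc b)" if "R > 0" for R
    using lower[of R] that by (simp add: field_simps)
  have ge: "1 / real (Suc b) - 1 / real R \<le> P R / real R ^ Suc b" if "R > 0" for R
  proof -
    have "real R ^ Suc b / real (Suc b) \<le> P R + real R ^ b"
      using upper[of R] by (simp add: P_def pos_divide_le_eq mult.commute)
    then have "real R ^ Suc b / real (Suc b) / real R ^ Suc b \<le> (P R + real R ^ b) / real R ^ Suc b"
      by (rule divide_right_mono) simp
    then show ?thesis using that by (simp add: add_divide_distrib)
  qed
  show ?thesis unfolding eq
  proof (rule tendsto_sandwich)
    show "\<forall>\<^sub>F R in sequentially. 1 / real (Suc b) - 1 / real R \<le> P R / real R ^ Suc b"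
      using eventually_gt_at_top[of 0] by eventually_elim (rule ge)
    show "\<forall>\<^sub>F R in sequentially. P R / real R ^ Suc b \<le> 1 / real (Suc b)"
      using eventually_gt_at_top[of 0] by eventually_elim (rule le)
    show "(\<lambda>R. 1 / real (Suc b) - 1 / real R) \<longlonglongrightarrow> 1 / real (Suc b)"
      using tendsto_diff[OF tendsto_const lim_1_over_n, of "1 / real (Suc b)"] by simp
  qed simp
qed

text \<open>Riemann sums of the Beta integral of (1-u)^c u^b, by induction through (1-u)^(c+1) u^b =
  (1-u)^c u^b - (1-u)^c u^(b+1).\<close>

lemma tendsto_beta_riemann_sum:
  "(\<lambda>R. (\<Sum>r<R. (1 - real r / real R) ^ c * (real r / real R) ^ b) / real R)
     \<longlonglongrightarrow> fact b * fact c / fact (b + c + 1)"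
proof (induction c arbitrary: b)
  case 0
  have "fact b * fact 0 / fact (b + 0 + 1) = 1 / real (Suc b)"
    by (simp add: nonzero_divide_mult_cancel_right del: of_nat_Suc)
  then show ?case using tendsto_power_riemann_sum[of b] by simp
next
  case (Suc c)
  have eq: "(\<Sum>r<R. (1 - real r / real R) ^ Suc c * (real r / real R) ^ b) / real R
      = (\<Sum>r<R. (1 - real r / real R) ^ c * (real r / real R) ^ b) / real R
      - (\<Sum>r<R. (1 - real r / real R) ^ c * (real r / real R) ^ Suc b) / real R" for R
    unfolding diff_divide_distrib[symmetric] sum_subtractf[symmetric]
    by (intro arg_cong2[of _ _ _ _ "(/)"] sum.cong refl) (simp add: algebra_simps)
  have "fact b * fact c / fact (b + c + 1) - fact (Suc b) * fact c / fact (Suc b + c + 1)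
      = (fact b * fact (Suc c) / fact (b + Suc c + 1) :: real)"
  proof -
    have "fact (Suc b + c + 1) = real (b + c + 2) * fact (b + c + 1)" by simp
    then show ?thesis by (simp add: divide_simps) (simp add: algebra_simps)
  qed
  then show ?case
    using tendsto_diff[OF Suc.IH[of b] Suc.IH[of "Suc b"]] unfolding eq by simp
qed

section \<open>Moments of the discrete sphere averages\<close>

definition sphere_moment :: "nat \<Rightarrow> nat \<Rightarrow> nat \<Rightarrow> nat \<Rightarrow> complex" where
  "sphere_moment R m a b = sphere_avg R m (\<lambda>z. z ^ a * cnj z ^ b)"

lemma sphere_moment_0:
  assumes "a + b < R"
  shows "sphere_moment R 0 a b = (if a = b then 1 else 0)"
proof -
  define w where "w s = cis (2 * pi * real s / real R)" for s
  have "sphere_moment R 0 a b = (\<Sum>s<R. \<Sum>s'<R. of_real (1 / real R * (1 / real R)) *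
      ((w s ^ a * cnj (w s) ^ b) * (w s' ^ b * cnj (w s') ^ a)))"
    unfolding sphere_moment_def sphere_avg.simps kernel_avg_def w_def
    by (intro sum.cong refl) (simp add: power_mult_distrib mult_ac)
  also have "\<dots> = of_real (1 / real R * (1 / real R)) *
      ((\<Sum>s<R. w s ^ a * cnj (w s) ^ b) * (\<Sum>s'<R. w s' ^ b * cnj (w s') ^ a))"
    unfolding sum_product unfolding sum_distrib_left ..
  also have "\<dots> = (if a = b then 1 else 0)"
    using assms unfolding w_def by (subst (1 2) sum_roots_of_unity) auto
  finally show ?thesis .
qed

text \<open>The angular sum leaves only i = j; the factors sqrt(u)^i and sqrt(u)^j then combine to
  u^i, and a radial sum remains.\<close>

lemma sphere_coord_moment:
  assumes "i + j < R"
  shows "(\<Sum>\<kappa>\<in>{..<R} \<times> {..<R}. of_real (sphere_weight m R \<kappa> * sphere_scale R \<kappa> ^ p) *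
      sphere_coord R \<kappa> ^ i * cnj (sphere_coord R \<kappa>) ^ j)
    = (if i = j then of_real (real (Suc m) *
        ((\<Sum>r<R. (1 - real r / real R) ^ m * sqrt (1 - real r / real R) ^ p * (real r / real R) ^ i) / real R)) else 0)"
proof -
  define w where "w s = cis (2 * pi * real s / real R)" for s
  have R: "real R > 0" using assms by simp
  have factor: "of_real (c * y ^ p) * (of_real u * z) ^ i * cnj (of_real u * z) ^ j
      = of_real (c * y ^ p * u ^ (i + j)) * (z ^ i * cnj z ^ j)" for c y u and z :: complex
    by (simp add: power_mult_distrib power_add mult_ac)
  have "(\<Sum>\<kappa>\<in>{..<R} \<times> {..<R}. of_real (sphere_weight m R \<kappa> * sphere_scale R \<kappa> ^ p) *
      sphere_coord R \<kappa> ^ i * cnj (sphere_coord R \<kappa>) ^ j)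
    = (\<Sum>r<R. \<Sum>s<R. of_real (real (Suc m) * (1 - real r / real R) ^ m / (real R)\<^sup>2
        * sqrt (1 - real r / real R) ^ p * sqrt (real r / real R) ^ (i + j)) * (w s ^ i * cnj (w s) ^ j))"
    by (simp only: sum.cartesian_product' sphere_weight_def sphere_scale_def sphere_coord_def
          prod.case w_def factor)
  also have "\<dots> = (\<Sum>r<R. of_real (real (Suc m) * (1 - real r / real R) ^ m / (real R)\<^sup>2
        * sqrt (1 - real r / real R) ^ p * sqrt (real r / real R) ^ (i + j))) * (\<Sum>s<R. w s ^ i * cnj (w s) ^ j)"
    unfolding sum_product ..
  also have "(\<Sum>s<R. w s ^ i * cnj (w s) ^ j) = (if i = j then of_nat R else 0)"
    unfolding w_def by (rule sum_roots_of_unity[OF assms])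
  also have "(\<Sum>r<R. of_real (real (Suc m) * (1 - real r / real R) ^ m / (real R)\<^sup>2
        * sqrt (1 - real r / real R) ^ p * sqrt (real r / real R) ^ (i + j))) * (if i = j then of_nat R else 0)
    = (if i = j then of_real (real (Suc m) *
        ((\<Sum>r<R. (1 - real r / real R) ^ m * sqrt (1 - real r / real R) ^ p * (real r / real R) ^ i) / real R)) else (0 :: complex))"
  proof (cases "i = j")
    case True
    have "(\<Sum>r<R. real (Suc m) * (1 - real r / real R) ^ m / (real R)\<^sup>2
        * sqrt (1 - real r / real R) ^ p * sqrt (real r / real R) ^ (i + j)) * real R
      = real (Suc m) * ((\<Sum>r<R. (1 - real r / real R) ^ m * sqrt (1 - real r / real R) ^ p * (real r / real R) ^ i) / real R)"
      unfolding sum_distrib_left sum_distrib_right sum_divide_distrib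
    proof (rule sum.cong[OF refl])
      fix r
      have "sqrt (real r / real R) ^ (i + j) = (real r / real R) ^ i"
        unfolding True mult_2[symmetric] power_mult by simp
      then show "real (Suc m) * (1 - real r / real R) ^ m / (real R)\<^sup>2
          * sqrt (1 - real r / real R) ^ p * sqrt (real r / real R) ^ (i + j) * real R
        = real (Suc m) * ((1 - real r / real R) ^ m * sqrt (1 - real r / real R) ^ p * (real r / real R) ^ i / real R)"
        using R by (simp add: power2_eq_square)
    qed
    from True arg_cong[OF this, of complex_of_real] show ?thesis
      by (simp only: simp_thms if_True of_real_sum of_real_mult of_real_of_nat_eq)
  qed simp
  finally show ?thesis .
qed

text \<open>Integrating out one coordinate. The radial sums appear squared because both points are
  averaged, and the exact angular sums reduce the two binomial indices to one.\<close>

lemma sphere_moment_Suc: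
  assumes "a + b < R"
  shows "sphere_moment R (Suc m) a b = (\<Sum>i\<le>min a b. of_nat (a choose i) * of_nat (b choose i) *
      of_real ((real (Suc m) * ((\<Sum>r<R. (1 - real r / real R) ^ m *
        sqrt (1 - real r / real R) ^ (a - i + (b - i)) * (real r / real R) ^ i) / real R))\<^sup>2) *
      sphere_moment R m (a - i) (b - i))"
proof -
  define J where "J i j = (cmod (\<Sum>\<kappa>\<in>{..<R} \<times> {..<R}.
      of_real (sphere_weight m R \<kappa> * sphere_scale R \<kappa> ^ (a - i + (b - j))) *
      sphere_coord R \<kappa> ^ i * cnj (sphere_coord R \<kappa>) ^ j))\<^sup>2" for i j
  define B where "B i = (real (Suc m) * ((\<Sum>r<R. (1 - real r / real R) ^ m *
        sqrt (1 - real r / real R) ^ (a - i + (b - i)) * (real r / real R) ^ i) / real R))\<^sup>2" for i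
  have J: "J i j = (if i = j then B i else 0)" if "i \<le> a" "j \<le> b" for i j
  proof -
    have "i + j < R" using that assms by simp
    then show ?thesis
      unfolding J_def B_def sphere_coord_moment[OF \<open>i + j < R\<close>]
      by (cases "i = j") (simp_all only: simp_thms if_True if_False norm_of_real norm_zero power2_abs power_zero_numeral)
  qed
  have "sphere_moment R (Suc m) a b = (\<Sum>i\<le>a. sphere_avg R m (\<lambda>z. \<Sum>j\<le>b.
      of_nat (a choose i) * of_nat (b choose j) * of_real (J i j) * (z ^ (a - i) * cnj z ^ (b - j))))"
    using sphere_avg_sum[of R m "\<lambda>_. 1" _ "{..a}"]
    unfolding sphere_moment_def sphere_avg.simps kernel_avg_moment[abs_def] J_def by simp
  also have "\<dots> = (\<Sum>i\<le>a. \<Sum>j\<le>b. of_nat (a choose i) * of_nat (b choose j) * of_real (J i j) *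
      sphere_moment R m (a - i) (b - j))"
    unfolding sphere_avg_sum sphere_moment_def ..
  also have "\<dots> = (\<Sum>i\<le>a. \<Sum>j\<le>b. if j = i then of_nat (a choose i) * of_nat (b choose i) * of_real (B i) *
      sphere_moment R m (a - i) (b - i) else 0)"
    by (intro sum.cong refl) (auto simp: J)
  also have "\<dots> = (\<Sum>i\<le>a. if i \<le> b then of_nat (a choose i) * of_nat (b choose i) * of_real (B i) *
      sphere_moment R m (a - i) (b - i) else 0)"
    by (simp add: sum.delta)
  also have "\<dots> = (\<Sum>i\<le>min a b. of_nat (a choose i) * of_nat (b choose i) * of_real (B i) *
      sphere_moment R m (a - i) (b - i))"
    by (rule sum.mono_neutral_cong_right) auto
  finally show ?thesis unfolding B_def .
qed

lemma sphere_moment_off_diagonal: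
  "a + b < R \<Longrightarrow> a \<noteq> b \<Longrightarrow> sphere_moment R m a b = 0"
proof (induction m arbitrary: a b)
  case 0
  then show ?case by (simp add: sphere_moment_0)
next
  case (Suc m)
  have "sphere_moment R m (a - i) (b - i) = 0" if "i \<le> min a b" for i
    using Suc.prems that by (intro Suc.IH) auto
  then show ?case by (subst sphere_moment_Suc[OF Suc.prems(1)]) simp
qed

text \<open>The limit is the mean of |z|^(2a) for one coordinate z of a uniform point of the unit
  sphere of C^(m+1). The recursion reproduces it by the hockey-stick identity: the sum of (m+k
  choose k) over k \<le> a is (a+m+1 choose a).\<close>

lemma tendsto_sphere_moment_diagonal:
  "(\<lambda>R. sphere_moment R m a a) \<longlonglongrightarrow> of_real (fact a * fact m / fact (a + m))"
proof (induction m arbitrary: a)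
  case 0
  have "\<forall>\<^sub>F R in sequentially. sphere_moment R 0 a a = 1"
    using eventually_gt_at_top[of "a + a"] by eventually_elim (simp add: sphere_moment_0)
  then show ?case by (intro tendsto_eventually) simp
next
  case (Suc m)
  define B where "B R i = (\<Sum>r<R. (1 - real r / real R) ^ (m + (a - i)) * (real r / real R) ^ i) / real R" for R i
  define L :: "nat \<Rightarrow> real" where "L i = fact i * fact (m + (a - i)) / fact (i + (m + (a - i)) + 1)" for i
  have "\<forall>\<^sub>F R in sequentially. sphere_moment R (Suc m) a a = (\<Sum>i\<le>a. of_nat (a choose i) * of_nat (a choose i) *
      of_real ((real (Suc m) * B R i)\<^sup>2) * sphere_moment R m (a - i) (a - i))"
    using eventually_gt_at_top[of "a + a"]
  proof eventually_elim
    case (elim R)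
    have "sqrt (1 - real r / real R) ^ (a - i + (a - i)) = (1 - real r / real R) ^ (a - i)" if "r < R" for r i
      unfolding mult_2[symmetric] power_mult using that by simp
    then have "(\<Sum>r<R. (1 - real r / real R) ^ m * sqrt (1 - real r / real R) ^ (a - i + (a - i)) * (real r / real R) ^ i) / real R
        = B R i" for i
      unfolding B_def by (simp add: power_add)
    then show ?case by (subst sphere_moment_Suc[OF elim]) (simp only: min.idem)
  qed
  moreover have "(\<lambda>R. \<Sum>i\<le>a. of_nat (a choose i) * of_nat (a choose i) *
      of_real ((real (Suc m) * B R i)\<^sup>2) * sphere_moment R m (a - i) (a - i)) \<longlonglongrightarrow>
      (\<Sum>i\<le>a. of_nat (a choose i) * of_nat (a choose i) *
      of_real ((real (Suc m) * L i)\<^sup>2) * of_real (fact (a - i) * fact m / fact (a - i + m)))"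
    unfolding B_def L_def by (intro tendsto_intros Suc.IH tendsto_beta_riemann_sum)
  moreover have "(\<Sum>i\<le>a. of_nat (a choose i) * of_nat (a choose i) *
      of_real ((real (Suc m) * L i)\<^sup>2) * of_real (fact (a - i) * fact m / fact (a - i + m)))
      = (of_real (fact a * fact (Suc m) / fact (a + Suc m)) :: complex)"
  proof -
    have "(\<Sum>i\<le>a. real (a choose i) * real (a choose i) * (real (Suc m) * L i)\<^sup>2 * (fact (a - i) * fact m / fact (a - i + m)))
        = (\<Sum>i\<le>a. (fact a * fact (Suc m) / fact (a + Suc m))\<^sup>2 * real (m + (a - i) choose (a - i)))"
    proof (rule sum.cong[OF refl])
      fix i assume "i \<in> {..a}"
      then have i: "i \<le> a" by simp
      have 1: "real (a choose i) = fact a / (fact i * fact (a - i))"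
        "real (m + (a - i) choose (a - i)) = fact (m + (a - i)) / (fact (a - i) * fact m)"
        using i by (simp_all add: binomial_fact)
      have 2: "i + (m + (a - i)) + 1 = a + Suc m" using i by simp
      show "real (a choose i) * real (a choose i) * (real (Suc m) * L i)\<^sup>2 * (fact (a - i) * fact m / fact (a - i + m))
          = (fact a * fact (Suc m) / fact (a + Suc m))\<^sup>2 * real (m + (a - i) choose (a - i))"
        unfolding L_def 2 1 add.commute[of "a - i" m] fact_Suc[of m]
        by (simp add: power2_eq_square divide_simps)
    qed
    also have "\<dots> = (fact a * fact (Suc m) / fact (a + Suc m))\<^sup>2 * real (\<Sum>k\<le>a. m + k choose k)"
      unfolding sum_distrib_left[symmetric] of_nat_sum
      by (intro arg_cong2[of _ _ _ _ "(*)"] refl sum.reindex_bij_witness[of _ "\<lambda>k. a - k" "\<lambda>k. a - k"]) auto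
    also have "real (\<Sum>k\<le>a. m + k choose k) = fact (a + Suc m) / (fact a * fact (Suc m))"
      unfolding sum_choose_lower by (simp add: binomial_fact add.commute del: fact_Suc)
    finally have "(\<Sum>i\<le>a. real (a choose i) * real (a choose i) * (real (Suc m) * L i)\<^sup>2 * (fact (a - i) * fact m / fact (a - i + m)))
      = fact a * fact (Suc m) / fact (a + Suc m)" by (simp add: power2_eq_square divide_simps del: fact_Suc)
    from this[symmetric] show ?thesis by (simp only: of_real_sum of_real_mult of_real_of_nat_eq)
  qed
  ultimately show ?case by (simp add: tendsto_cong)
qed

text \<open>Up to a constant factor, the integral of \<open>Re z ^ j * z ^ n\<close> over the unit disc against
  the density \<open>(1 - \<bar>z\<bar>\<^sup>2) ^ (m - 1)\<close> (over the unit circle if \<open>m = 0\<close>).\<close>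

definition disc_moment :: "nat \<Rightarrow> nat \<Rightarrow> nat \<Rightarrow> real" where
  "disc_moment m n j = (if n \<le> j \<and> even (j - n)
     then fact j / (2 ^ j * fact ((j - n) div 2) * fact (n + (j - n) div 2 + m)) else 0)"

text \<open>The condition b + n = j - b has the single solution b = (j - n) / 2. \<open>F\<close> is
  left open because sphere moments and circle integrals both use the formula.\<close>

lemma sum_choose_diagonal:
  "(\<Sum>b\<le>j. real (j choose b) * (if b + n = j - b then F (b + n) else 0))
    = (if n \<le> j \<and> even (j - n)
       then fact j / (fact ((j - n) div 2) * fact (n + (j - n) div 2)) * F (n + (j - n) div 2) else 0)"
proof (cases "n \<le> j \<and> even (j - n)")
  case True
  define b0 where "b0 = (j - n) div 2"
  have j: "j = n + 2 * b0" using True by (auto simp: b0_def)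
  have "(\<Sum>b\<le>j. real (j choose b) * (if b + n = j - b then F (b + n) else 0))
      = (\<Sum>b\<le>j. if b = b0 then real (j choose b0) * F (b0 + n) else 0)"
    by (intro sum.cong) (auto simp: j)
  also have "\<dots> = real (j choose b0) * F (b0 + n)" by (simp add: j)
  also have "real (j choose b0) = fact j / (fact b0 * fact (n + b0))"
    by (subst binomial_fact) (auto simp: j mult_2)
  finally show ?thesis by (simp only: if_P[OF True] b0_def[symmetric] add.commute[of b0 n])
next
  case False
  then have "b + n \<noteq> j - b" if "b \<le> j" for b using that by presburger
  then show ?thesis using False by (subst sum.neutral) auto
qed

section \<open>Limits of polynomial averages and their positivity\<close>

lemma tendsto_sphere_moment:
  "(\<lambda>R. sphere_moment R m a b) \<longlonglongrightarrow> of_real (if a = b then fact a * fact m / fact (a + m) else 0)"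
proof (cases "a = b")
  case False
  have "\<forall>\<^sub>F R in sequentially. sphere_moment R m a b = 0"
    using eventually_gt_at_top[of "a + b"] by eventually_elim (simp add: False sphere_moment_off_diagonal)
  then show ?thesis using False by (simp add: tendsto_eventually)
qed (use tendsto_sphere_moment_diagonal in simp)

lemma Re_power_times_power:
  "of_real (Re z) ^ j * z ^ n
      = (\<Sum>b\<le>j. of_real (real (j choose b) / 2 ^ j) * (z ^ (b + n) * cnj z ^ (j - b)))"
proof -
  have "of_real (Re z) = (z + cnj z) / 2" by (simp add: complex_add_cnj)
  then have "of_real (Re z) ^ j * z ^ n = (\<Sum>b\<le>j. of_nat (j choose b) * z ^ b * cnj z ^ (j - b)) / 2 ^ j * z ^ n"
    by (simp only: power_divide binomial_ring)
  also have "\<dots> = (\<Sum>b\<le>j. of_nat (j choose b) * z ^ b * cnj z ^ (j - b) / 2 ^ j * z ^ n)"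
    by (simp only: sum_divide_distrib sum_distrib_right)
  also have "\<dots> = (\<Sum>b\<le>j. of_real (real (j choose b) / 2 ^ j) * (z ^ (b + n) * cnj z ^ (j - b)))"
    by (rule sum.cong[OF refl]) (simp add: power_add)
  finally show ?thesis .
qed

lemma tendsto_sphere_avg_Re_power:
  "(\<lambda>R. sphere_avg R m (\<lambda>z. of_real (Re z) ^ j * z ^ n)) \<longlonglongrightarrow> of_real (fact m * disc_moment m n j)"
proof -
  have "(\<lambda>R. \<Sum>b\<le>j. of_real (real (j choose b) / 2 ^ j) * sphere_moment R m (b + n) (j - b)) \<longlonglongrightarrow>
      (\<Sum>b\<le>j. of_real (real (j choose b) / 2 ^ j) *
        of_real (if b + n = j - b then fact (b + n) * fact m / fact (b + n + m) else 0))"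
    by (intro tendsto_intros tendsto_sphere_moment)
  also have "(\<Sum>b\<le>j. of_real (real (j choose b) / 2 ^ j) *
        of_real (if b + n = j - b then fact (b + n) * fact m / fact (b + n + m) else 0))
      = complex_of_real ((\<Sum>b\<le>j. real (j choose b) *
          (if b + n = j - b then (\<lambda>i. fact i * fact m / fact (i + m)) (b + n) else 0)) / 2 ^ j)"
    unfolding sum_divide_distrib of_real_sum
    by (rule sum.cong[OF refl]) simp
  also have "(\<Sum>b\<le>j. real (j choose b) *
          (if b + n = j - b then (\<lambda>i. fact i * fact m / fact (i + m)) (b + n) else 0)) / 2 ^ j
      = fact m * disc_moment m n j"
    unfolding sum_choose_diagonal[where F = "\<lambda>i. fact i * fact m / fact (i + m)"] disc_moment_def
    by (cases "n \<le> j \<and> even (j - n)") (simp_all only: if_P if_not_P simp_thms if_False, simp_all add: mult_ac)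
  finally show ?thesis
    unfolding Re_power_times_power sphere_avg_sum sphere_moment_def[symmetric] .
qed

text \<open>Positivity holds for the finite averages of \<open>f\<close> and passes to those of the
  polynomial at the cost of \<epsilon> times the total mass. The limit is taken afterwards, and
  there the mass tends to 1.\<close>

lemma disc_moment_functional_ge:
  assumes f: "cpsd (Suc m) (\<lambda>z. of_real (f (Re z)))"
    and approx: "\<And>t. \<bar>t\<bar> \<le> 1 \<Longrightarrow> \<bar>f t - (\<Sum>i\<le>N. a i * t ^ i)\<bar> \<le> \<epsilon>"
  shows "- \<epsilon> \<le> fact m * (\<Sum>i\<le>N. a i * disc_moment m n i)"
proof -
  define G where "G z = of_real (f (Re z)) * z ^ n" for z
  define H where "H z = (\<Sum>i\<le>N. of_real (a i) * (of_real (Re z) ^ i * z ^ n))" for z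
  have diff: "cmod (G z - H z) \<le> \<epsilon>" if z: "cmod z \<le> 1" for z
  proof -
    have "H z = of_real (\<Sum>i\<le>N. a i * Re z ^ i) * z ^ n"
      by (simp add: H_def sum_distrib_right mult.assoc)
    then have "G z - H z = of_real (f (Re z) - (\<Sum>i\<le>N. a i * Re z ^ i)) * z ^ n"
      by (simp add: G_def left_diff_distrib)
    then have "cmod (G z - H z) = \<bar>f (Re z) - (\<Sum>i\<le>N. a i * Re z ^ i)\<bar> * cmod z ^ n"
      by (simp only: norm_mult norm_power norm_of_real)
    also have "\<dots> \<le> \<epsilon> * 1"
      using z abs_Re_le_cmod[of z] order_trans[OF abs_ge_zero approx[of 0]]
      by (intro mult_mono approx power_le_one) auto
    finally show ?thesis by simp
  qed
  have nonneg: "0 \<le> Re (sphere_avg R m H) + \<epsilon> * Re (sphere_moment R m 0 0)" for R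
  proof -
    have "0 \<le> Re (sphere_avg R m G)"
      unfolding G_def by (intro sphere_avg_nonneg cpsd_mult_power f)
    also have "sphere_avg R m G = sphere_avg R m H + sphere_avg R m (\<lambda>z. G z - H z)"
      by (simp add: sphere_avg_diff)
    also have "Re (sphere_avg R m H + sphere_avg R m (\<lambda>z. G z - H z))
        \<le> Re (sphere_avg R m H) + cmod (sphere_avg R m (\<lambda>z. G z - H z))"
      by (simp add: complex_Re_le_cmod)
    also have "\<dots> \<le> Re (sphere_avg R m H) + \<epsilon> * Re (sphere_moment R m 0 0)"
      using cmod_sphere_avg_le[OF diff, of "\<lambda>z. z"] by (simp add: sphere_moment_def)
    finally show ?thesis .
  qed
  have "(\<lambda>R. sphere_avg R m H) \<longlonglongrightarrow> (\<Sum>i\<le>N. of_real (a i) * of_real (fact m * disc_moment m n i))"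
    unfolding H_def sphere_avg_sum by (intro tendsto_intros tendsto_sphere_avg_Re_power)
  also have "(\<Sum>i\<le>N. of_real (a i) * of_real (fact m * disc_moment m n i))
      = complex_of_real (fact m * (\<Sum>i\<le>N. a i * disc_moment m n i))"
    by (simp add: sum_distrib_left mult_ac)
  finally have "(\<lambda>R. Re (sphere_avg R m H) + \<epsilon> * Re (sphere_moment R m 0 0)) \<longlonglongrightarrow>
      Re (complex_of_real (fact m * (\<Sum>i\<le>N. a i * disc_moment m n i)))
      + \<epsilon> * Re (of_real (if (0::nat) = 0 then fact 0 * fact m / fact (0 + m) else 0))"
    by (intro tendsto_intros tendsto_sphere_moment)
  then have "0 \<le> Re (complex_of_real (fact m * (\<Sum>i\<le>N. a i * disc_moment m n i)))
      + \<epsilon> * Re (of_real (if (0::nat) = 0 then fact 0 * fact m / fact (0 + m) else 0))"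
    by (rule tendsto_lowerbound) (auto intro!: always_eventually nonneg)
  then show ?thesis by simp
qed

section \<open>From the real to the complex sphere\<close>

lemma sum_real_imag_parts:
  "(\<Sum>k<2 * N. (if even k then Re (x (k div 2)) else Im (x (k div 2))) *
      (if even k then Re (y (k div 2)) else Im (y (k div 2))))
    = Re (\<Sum>l<(N::nat). x l * cnj (y l))"
  by (induction N) simp_all

text \<open>Complex coordinates are unfolded into interleaved real and imaginary parts, padded by
  zeros, so that the Euclidean inner product is the real part of the Hermitian one. The padding is
  the restriction from even to odd dimension.\<close>

lemma Psi_class_imp_cpsd:
  assumes \<psi>: "\<psi> \<in> Psi_class TYPE('n::finite)" and N: "2 * N \<le> CARD('n)"
  shows "cpsd N (\<lambda>z. of_real (\<psi> (arccos (Re z))))"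
  unfolding cpsd_def
proof (intro allI impI)
  fix n and x :: "nat \<Rightarrow> nat \<Rightarrow> complex" and c :: "nat \<Rightarrow> complex"
  assume x: "\<forall>i<n. (\<Sum>l<N. (cmod (x i l))\<^sup>2) = 1"
  obtain h :: "'n \<Rightarrow> nat" where h: "bij_betw h UNIV {..<CARD('n)}"
    using ex_bij_betw_finite_nat[of "UNIV :: 'n set"] by (auto simp: atLeast0LessThan)
  define part where "part y k = (if k < 2 * N then if even k then Re (y (k div 2)) else Im (y (k div 2)) else 0)"
    for y :: "nat \<Rightarrow> complex" and k
  define v :: "(nat \<Rightarrow> complex) \<Rightarrow> real ^ 'n" where "v y = (\<chi> i. part y (h i))" for y
  have inner: "v y \<bullet> v z = Re (\<Sum>l<N. y l * cnj (z l))" for y z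
  proof -
    have "v y \<bullet> v z = (\<Sum>i\<in>UNIV. part y (h i) * part z (h i))"
      by (simp add: inner_vec_def v_def)
    also have "\<dots> = (\<Sum>k<CARD('n). part y k * part z k)"
      by (rule sum.reindex_bij_betw[OF h])
    also have "\<dots> = (\<Sum>k<2 * N. (if even k then Re (y (k div 2)) else Im (y (k div 2))) *
      (if even k then Re (z (k div 2)) else Im (z (k div 2))))"
      by (rule sum.mono_neutral_cong_right) (use N in \<open>auto simp: part_def\<close>)
    finally show ?thesis unfolding sum_real_imag_parts .
  qed
  have unit: "v (x i) \<in> sphere 0 1" if "i < n" for i
  proof -
    have "v (x i) \<bullet> v (x i) = (\<Sum>l<N. (cmod (x i l))\<^sup>2)"
      unfolding inner Re_sum by (intro sum.cong refl) (simp add: cmod_power2 flip: power2_eq_square)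
    then show ?thesis using x that by (simp add: norm_eq_sqrt_inner)
  qed
  define g where "g i j = \<psi> (arccos (Re (\<Sum>l<N. x i l * cnj (x j l))))" for i j
  have nonneg_real: "0 \<le> (\<Sum>i<n. \<Sum>j<n. r i * r j * g i j)" for r
  proof (cases "n = 0")
    case False
    have "0 \<le> (\<Sum>i=1..n. \<Sum>j=1..n. r (i - 1) * r (j - 1) * \<psi> (sphere_dist (v (x (i - 1))) (v (x (j - 1)))))"
    proof -
      have "positive_definite_on (sphere (0 :: real ^ 'n) 1) (\<lambda>x y. \<psi> (sphere_dist x y))"
        using \<psi> by (simp add: Psi_class_def)
      moreover have "\<forall>i\<in>{1..n}. v (x (i - 1)) \<in> sphere 0 1" using unit by auto
      ultimately show ?thesis using False unfolding positive_definite_on_def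
        by (elim allE[of _ n] impE allE[of _ "\<lambda>i. v (x (i - 1))"] allE[of _ "\<lambda>i. r (i - 1)"]) auto
    qed
    then show ?thesis
      by (simp add: sum.atLeast1_atMost_eq sphere_dist_def inner g_def)
  qed simp
  \<comment> \<open>For a real kernel the real part of the form splits into the forms of the real
    and of the imaginary parts of the weights.\<close>
  have "Re (\<Sum>i<n. \<Sum>j<n. c i * cnj (c j) * of_real (g i j))
      = (\<Sum>i<n. \<Sum>j<n. Re (c i) * Re (c j) * g i j) + (\<Sum>i<n. \<Sum>j<n. Im (c i) * Im (c j) * g i j)"
    unfolding Re_sum sum.distrib[symmetric] by (intro sum.cong refl) (simp add: distrib_right)
  then have "0 \<le> Re (\<Sum>i<n. \<Sum>j<n. c i * cnj (c j) * of_real (g i j))"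
    using nonneg_real[of "\<lambda>i. Re (c i)"] nonneg_real[of "\<lambda>i. Im (c i)"] by linarith
  then show "0 \<le> Re (\<Sum>i<n. \<Sum>j<n. c i * cnj (c j) * of_real (\<psi> (arccos (Re (\<Sum>l<N. x i l * cnj (x j l))))))"
    unfolding g_def .
qed

section \<open>Cosine coefficients of iterated primitives\<close>

text \<open>An integral over a reversed interval is 0, so the difference is the oriented integral
  from 0 to \<open>x\<close> for either sign of \<open>x\<close>.\<close>

definition sin_primitive :: "(real \<Rightarrow> real) \<Rightarrow> real \<Rightarrow> real" where
  "sin_primitive g x = integral {0..x} (\<lambda>t. g t * sin t) - integral {x..0} (\<lambda>t. g t * sin t)"

lemma sin_primitive_0 [simp]: "sin_primitive g 0 = 0"
  by (simp add: sin_primitive_def)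

lemma DERIV_sin_primitive:
  assumes "continuous_on UNIV g"
  shows "(sin_primitive g has_real_derivative g x * sin x) (at x)"
proof -
  \<comment> \<open>With base point -c both 0 and \<open>x\<close> are interior, so the derivative
    within the interval is two-sided.\<close>
  define c where "c = \<bar>x\<bar> + 1"
  define h where "h t = g t * sin t" for t
  have cont: "continuous_on A h" for A
    unfolding h_def by (intro continuous_intros continuous_on_subset[OF assms]) auto
  have int: "h integrable_on {a..b}" for a b by (intro integrable_continuous_interval cont)
  have "x \<in> {-c..c}" by (auto simp: c_def)
  from DERIV_diff[OF integral_has_real_derivative[OF cont this] DERIV_const]
  have "((\<lambda>y. integral {-c..y} h - integral {-c..0} h) has_real_derivative h x) (at x within {-c..c})"
    by simp
  then have "((\<lambda>y. integral {-c..y} h - integral {-c..0} h) has_real_derivative h x) (at x)"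
    by (subst (asm) at_within_interior) (auto simp: c_def)
  then show ?thesis
    unfolding h_def[symmetric]
  proof (rule has_field_derivative_transform_within_open[where S = "{-c<..<c}"])
    fix y assume y: "y \<in> {-c<..<c}"
    show "integral {-c..y} h - integral {-c..0} h = sin_primitive g y"
    proof (cases "0 \<le> y")
      case True
      have "integral {-c..0} h + integral {0..y} h = integral {-c..y} h"
        using y True by (intro Henstock_Kurzweil_Integration.integral_combine int) (auto simp: c_def)
      moreover have "integral {y..0} h = 0" using True by (cases "y = 0") auto
      ultimately show ?thesis unfolding sin_primitive_def h_def by simp
    next
      case False
      have "integral {-c..y} h + integral {y..0} h = integral {-c..0} h"
        using y False by (intro Henstock_Kurzweil_Integration.integral_combine int) auto
      moreover have "integral {0..y} h = 0" using False by simp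
      ultimately show ?thesis unfolding sin_primitive_def h_def by simp
    qed
  qed (auto simp: c_def)
qed

lemma continuous_on_sin_primitive: "continuous_on UNIV g \<Longrightarrow> continuous_on A (sin_primitive g)"
  by (rule DERIV_continuous_on[OF has_field_derivative_at_within[OF DERIV_sin_primitive]])

lemma continuous_on_sin_primitive_funpow:
  "continuous_on UNIV g \<Longrightarrow> continuous_on UNIV ((sin_primitive ^^ m) g)"
  by (induction m) (simp_all add: continuous_on_sin_primitive)

lemma sin_primitive_even:
  assumes "continuous_on UNIV g" "\<And>x. g (- x) = g x"
  shows "sin_primitive g (- x) = sin_primitive g x"
proof -
  define r where "r x = sin_primitive g (- x) - sin_primitive g x" for x
  have "(r has_real_derivative 0) (at x)" for x
  proof -
    have "((\<lambda>x. - x) has_real_derivative - 1) (at x)" by (rule derivative_eq_intros refl)+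
    from DERIV_chain2[OF DERIV_sin_primitive[OF assms(1)] this]
    have "((\<lambda>x. sin_primitive g (- x)) has_real_derivative g x * sin x) (at x)" by (simp add: assms(2))
    from DERIV_diff[OF this DERIV_sin_primitive[OF assms(1)]] show ?thesis
      unfolding r_def[abs_def] by simp
  qed
  then have "r x = r 0" by (intro DERIV_isconst_all) auto
  then show ?thesis by (simp add: r_def)
qed

lemma sin_primitive_funpow_even:
  assumes "continuous_on UNIV g" "\<And>x. g (- x) = g x"
  shows "(sin_primitive ^^ m) g (- x) = (sin_primitive ^^ m) g x"
proof (induction m arbitrary: x)
  case (Suc m)
  show ?case unfolding funpow.simps o_apply
    by (rule sin_primitive_even[OF continuous_on_sin_primitive_funpow[OF assms(1)] Suc])
qed (simp add: assms)

text \<open>Integration by parts against sin((n+1)x)/(n+1), whose boundary terms vanish; sin x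
  sin((n+1)x) splits into the cosines of index n and n + 2. The index moves up by one, so index 0 is
  not covered.\<close>

lemma cos_coeff_sin_primitive:
  assumes g: "continuous_on UNIV g"
  shows "cos_coeff (sin_primitive g) (Suc n) = - ((cos_coeff g n - cos_coeff g (n + 2)) / (2 * real (Suc n)))"
proof -
  define c where "c = real (Suc n)"
  have c: "c > 0" "c = real n + 1" by (simp_all add: c_def)
  have g': "continuous_on A g" for A using g by (rule continuous_on_subset) simp
  have cT: "continuous_on A (sin_primitive g)" for A by (rule continuous_on_sin_primitive[OF g])
  have "((\<lambda>x. g x * sin x * (sin (c * x) / c) + cos (c * x) * sin_primitive g x) has_integral
      sin_primitive g pi * (sin (c * pi) / c) - sin_primitive g 0 * (sin (c * 0) / c)) {0..pi}"
  proof (rule fundamental_theorem_of_calculus)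
    fix x
    have "((\<lambda>x. sin (c * x) / c) has_real_derivative cos (c * x)) (at x)"
      using c by (auto intro!: derivative_eq_intros)
    from DERIV_mult[OF DERIV_sin_primitive[OF g] this]
    show "((\<lambda>x. sin_primitive g x * (sin (c * x) / c)) has_vector_derivative
        g x * sin x * (sin (c * x) / c) + cos (c * x) * sin_primitive g x) (at x within {0..pi})"
      unfolding has_real_derivative_iff_has_vector_derivative[symmetric]
      by (rule has_field_derivative_at_within)
  qed simp
  moreover have "sin (c * pi) = 0" unfolding c_def by (rule sin_npi)
  ultimately have zero: "integral {0..pi} (\<lambda>x. g x * sin x * (sin (c * x) / c) + cos (c * x) * sin_primitive g x) = 0"
    by (simp add: integral_unique)
  have integrand: "g x * sin x * (sin (c * x) / c) + cos (c * x) * sin_primitive g x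
      = (g x * cos (real n * x) - g x * cos (real (n + 2) * x)) / (2 * c) + sin_primitive g x * cos (c * x)" for x
  proof -
    have "sin (c * x) * sin x = (cos (real n * x) - cos (real (n + 2) * x)) / 2"
      unfolding sin_times_sin c(2) by (simp add: algebra_simps)
    then have "g x * sin x * (sin (c * x) / c) = g x * ((cos (real n * x) - cos (real (n + 2) * x)) / 2) / c"
      by (metis (no_types, opaque_lifting) mult.assoc mult.commute times_divide_eq_right)
    also have "\<dots> = (g x * cos (real n * x) - g x * cos (real (n + 2) * x)) / (2 * c)"
      by (simp add: right_diff_distrib)
    finally show ?thesis by simp
  qed
  have "0 = integral {0..pi} (\<lambda>x. (g x * cos (real n * x) - g x * cos (real (n + 2) * x)) / (2 * c)
      + sin_primitive g x * cos (c * x))"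
    using zero unfolding integrand by (rule sym)
  also have "\<dots> = integral {0..pi} (\<lambda>x. (g x * cos (real n * x) - g x * cos (real (n + 2) * x)) / (2 * c))
      + integral {0..pi} (\<lambda>x. sin_primitive g x * cos (c * x))"
    by (rule integral_add; intro integrable_continuous_interval continuous_intros g' cT) (use c in simp_all)
  also have "integral {0..pi} (\<lambda>x. (g x * cos (real n * x) - g x * cos (real (n + 2) * x)) / (2 * c))
      = (cos_coeff g n - cos_coeff g (n + 2)) / (2 * c)"
    unfolding cos_coeff_def integral_divide
    by (rule arg_cong[where f = "\<lambda>z. z / (2 * c)"], rule integral_diff)
       (intro integrable_continuous_interval continuous_intros g')+
  finally show ?thesis unfolding c_def cos_coeff_def by simp
qed

text \<open>Up to sign, the coefficient of index \<open>n + m\<close> of the m-fold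
  \<open>sin_primitive\<close>, written through the cosine coefficients of \<open>g\<close>. In this
  form it involves \<open>g\<close> on [0, pi] only and is continuous in the supremum norm there, so
  polynomials in cos can be used.\<close>

fun iterated_coeff :: "nat \<Rightarrow> nat \<Rightarrow> (real \<Rightarrow> real) \<Rightarrow> real" where
  "iterated_coeff 0 n g = cos_coeff g n"
| "iterated_coeff (Suc m) n g = (iterated_coeff m n g - iterated_coeff m (n + 2) g) / (2 * real (n + m + 1))"

lemma cos_coeff_sin_primitive_funpow:
  assumes g: "continuous_on UNIV g"
  shows "cos_coeff ((sin_primitive ^^ m) g) (n + m) = (- 1) ^ m * iterated_coeff m n g"
proof (induction m arbitrary: n)
  case (Suc m)
  have "cos_coeff (sin_primitive ((sin_primitive ^^ m) g)) (Suc (n + m)) =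
      - ((cos_coeff ((sin_primitive ^^ m) g) (n + m) - cos_coeff ((sin_primitive ^^ m) g) ((n + 2) + m))
        / (2 * real (Suc (n + m))))"
    using cos_coeff_sin_primitive[OF continuous_on_sin_primitive_funpow[OF g]]
    by (simp add: add.commute add.left_commute)
  then show ?case unfolding Suc by (simp add: algebra_simps diff_divide_distrib)
qed simp

section \<open>Iterated coefficients compared with disc moments\<close>

lemma iterated_coeff_diff:
  assumes "continuous_on {0..pi} f" "continuous_on {0..pi} g"
  shows "iterated_coeff m n (\<lambda>x. f x - g x) = iterated_coeff m n f - iterated_coeff m n g"
proof (induction m arbitrary: n)
  case (Suc m)
  show ?case unfolding iterated_coeff.simps Suc diff_divide_distrib[symmetric]
    by (rule arg_cong[where f = "\<lambda>z. z / _"]) simp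
qed (simp add: cos_coeff_diff[OF assms])

text \<open>Each step divides a difference of two terms by at least 2, so the bound does not grow
  with \<open>m\<close>.\<close>

lemma abs_iterated_coeff_le:
  assumes "continuous_on {0..pi} g" "\<And>x. x \<in> {0..pi} \<Longrightarrow> \<bar>g x\<bar> \<le> B"
  shows "\<bar>iterated_coeff m n g\<bar> \<le> pi * B"
proof (induction m arbitrary: n)
  case 0
  show ?case unfolding iterated_coeff.simps by (rule abs_cos_coeff_le[OF assms])
next
  case (Suc m)
  have B: "0 \<le> pi * B" using order_trans[OF abs_ge_zero Suc[of n]] .
  have "\<bar>iterated_coeff m n g - iterated_coeff m (n + 2) g\<bar> \<le> 2 * (pi * B)"
    using Suc[of n] Suc[of "n + 2"] by linarith
  then have "\<bar>iterated_coeff (Suc m) n g\<bar> \<le> 2 * (pi * B) / (2 * real (n + m + 1))"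
    by (simp add: abs_divide divide_right_mono del: of_nat_add)
  also have "\<dots> = pi * B / real (n + m + 1)" by (rule mult_divide_mult_cancel_left) simp
  also have "\<dots> \<le> pi * B / 1" using B by (intro divide_left_mono) auto
  finally show ?case by simp
qed

text \<open>Up to a factor 2 this is the recursion defining \<open>iterated_coeff\<close>. For b =
  (j - n) / 2 > 0 the two moments differ by the factors n + m + b + 1 and b over a common
  denominator, whose difference is n + m + 1; for b = 0 the second moment vanishes.\<close>

lemma disc_moment_diff:
  "disc_moment m n j - disc_moment m (n + 2) j = real (n + m + 1) * disc_moment (Suc m) n j"
proof (cases "n \<le> j \<and> even (j - n)")
  case True
  define b where "b = (j - n) div 2"
  have j: "j = n + 2 * b" using True by (auto simp: b_def)
  show ?thesis
  proof (cases b)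
    case 0
    have "fact (Suc (n + m)) = real (n + m + 1) * fact (n + m)" by simp
    then show ?thesis unfolding j 0 by (simp add: disc_moment_def del: fact_Suc)
  next
    case (Suc b')
    have j': "j = (n + 2) + 2 * b'" using j Suc by simp
    have "disc_moment m n j = fact j / (2 ^ j * fact (Suc b') * fact (n + b' + m + 1))"
      unfolding j Suc by (simp add: disc_moment_def del: fact_Suc)
    moreover have "disc_moment m (n + 2) j = fact j / (2 ^ j * fact b' * fact (Suc (n + b' + m + 1)))"
      unfolding j' by (simp add: disc_moment_def ac_simps del: fact_Suc)
    moreover have "disc_moment (Suc m) n j = fact j / (2 ^ j * fact (Suc b') * fact (Suc (n + b' + m + 1)))"
      unfolding j Suc by (simp add: disc_moment_def ac_simps del: fact_Suc)
    moreover have "fact (Suc b') = real (Suc b') * fact b'"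
      "fact (Suc (n + b' + m + 1)) = real (n + b' + m + 2) * fact (n + b' + m + 1)"
      by (simp_all only: fact_Suc of_nat_id) simp
    moreover have "F / (T * (B * p) * q) - F / (T * p * (C * q)) = (C - B) * (F / (T * (B * p) * (C * q)))"
      if "T \<noteq> 0" "B \<noteq> 0" "p \<noteq> 0" "q \<noteq> 0" "C \<noteq> 0" for F T B p q C :: real
      using that by (simp add: field_simps)
    moreover have "real (n + m + 1) = real (n + b' + m + 2) - real (Suc b')" by simp
    ultimately show ?thesis by (simp only: fact_nonzero) simp
  qed
next
  case False
  then show ?thesis by (auto simp: disc_moment_def)
qed

text \<open>The circle case m = 0: the expansion of (Re z)^j z^n is evaluated at z = cis x.\<close>

lemma cos_coeff_cos_power: "cos_coeff (\<lambda>x. cos x ^ j) n = pi * disc_moment 0 n j"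
proof -
  have eq: "cos x ^ j * cos (real n * x)
      = (\<Sum>b\<le>j. real (j choose b) / 2 ^ j * cos ((real (b + n) - real (j - b)) * x))" for x
  proof -
    have "cis x ^ (b + n) * cnj (cis x) ^ (j - b) = cis ((real (b + n) - real (j - b)) * x)" for b
      by (simp add: cis_cnj Complex.DeMoivre cis_mult left_diff_distrib del: of_nat_add)
    then have "of_real (Re (cis x)) ^ j * cis x ^ n
        = (\<Sum>b\<le>j. of_real (real (j choose b) / 2 ^ j) * cis ((real (b + n) - real (j - b)) * x))"
      unfolding Re_power_times_power by simp
    then have "Re (of_real (cos x ^ j) * cis (real n * x))
        = Re (\<Sum>b\<le>j. of_real (real (j choose b) / 2 ^ j) * cis ((real (b + n) - real (j - b)) * x))"
      by (simp only: Complex.DeMoivre cis.sel(1) of_real_power)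
    then show ?thesis by (simp only: Re_sum Re_complex_of_real times_complex.sel Im_complex_of_real cis.sel) simp
  qed
  have "cos_coeff (\<lambda>x. cos x ^ j) n
      = (\<Sum>b\<le>j. integral {0..pi} (\<lambda>x. real (j choose b) / 2 ^ j * cos ((real (b + n) - real (j - b)) * x)))"
    unfolding cos_coeff_def eq
    by (rule integral_sum; (intro integrable_continuous_interval continuous_intros)?) simp
  also have "\<dots> = (\<Sum>b\<le>j. real (j choose b) * (if b + n = j - b then (\<lambda>_. pi) (b + n) else 0)) / 2 ^ j"
    unfolding sum_divide_distrib by (rule sum.cong[OF refl]) (simp only: integral_mult_right integral_cos_diff, simp)
  also have "\<dots> = pi * disc_moment 0 n j"
    unfolding sum_choose_diagonal[where F = "\<lambda>_. pi"] disc_moment_def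
    by (cases "n \<le> j \<and> even (j - n)") (simp_all only: if_P if_not_P simp_thms if_False, simp_all add: mult_ac)
  finally show ?thesis .
qed

text \<open>Both sides follow the same recursion in \<open>m\<close>, starting from the circle. Thus
  iterated coefficients and limits of sphere averages agree on monomials up to a positive constant
  independent of \<open>j\<close>.\<close>

lemma iterated_coeff_cos_power: "iterated_coeff m n (\<lambda>x. cos x ^ j) = pi / 2 ^ m * disc_moment m n j"
proof (induction m arbitrary: n)
  case (Suc m)
  have "iterated_coeff (Suc m) n (\<lambda>x. cos x ^ j)
      = pi / 2 ^ m * (disc_moment m n j - disc_moment m (n + 2) j) / (2 * real (n + m + 1))"
    by (simp add: Suc right_diff_distrib del: of_nat_add)
  also have "\<dots> = pi / 2 ^ Suc m * disc_moment (Suc m) n j"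
    unfolding disc_moment_diff by (simp del: of_nat_add of_nat_Suc add_Suc_right)
  finally show ?case .
qed (simp add: cos_coeff_cos_power)

lemma iterated_coeff_cos_polynomial:
  "iterated_coeff m n (\<lambda>x. \<Sum>i\<le>N. a i * cos x ^ i) = pi / 2 ^ m * (\<Sum>i\<le>N. a i * disc_moment m n i)"
proof -
  have lin: "iterated_coeff m n (\<lambda>x. \<Sum>i\<le>N. a i * cos x ^ i) = (\<Sum>i\<le>N. a i * iterated_coeff m n (\<lambda>x. cos x ^ i))"
  proof (induction m arbitrary: n)
    case 0
    show ?case
      unfolding iterated_coeff.simps lessThan_Suc_atMost[symmetric]
      by (subst cos_coeff_sum) (auto intro!: continuous_intros simp: cos_coeff_cmult)
  next
    case (Suc m)
    show ?case
      by (simp add: Suc sum_subtractf[symmetric] right_diff_distrib sum_divide_distrib del: of_nat_add)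
  qed
  show ?thesis unfolding lin iterated_coeff_cos_power by (simp add: sum_distrib_left mult_ac)
qed

lemma iterated_coeff_nonneg:
  assumes \<psi>: "\<psi> \<in> Psi_class TYPE('n::finite)" and m: "2 * Suc m \<le> CARD('n)"
  shows "0 \<le> iterated_coeff m n (\<lambda>x. \<psi> (arccos (cos x)))"
proof (rule field_le_epsilon)
  fix e :: real assume "0 < e"
  \<comment> \<open>Two errors of at most pi times \<epsilon> arise below: from the lower bound for
    the polynomial, and from replacing \<psi> by it.\<close>
  define \<epsilon> where "\<epsilon> = e / (2 * pi)"
  have \<epsilon>: "0 < \<epsilon>" using \<open>0 < e\<close> by (simp add: \<epsilon>_def)
  have cont\<psi>: "continuous_on {0..pi} \<psi>" using \<psi> by (simp add: Psi_class_def)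
  have cont: "continuous_on {-1..1} (\<lambda>t. \<psi> (arccos t))"
    by (intro continuous_on_compose2[OF cont\<psi>] continuous_on_arccos') (auto simp: arccos_lbound arccos_ubound)
  have "\<exists>p. real_polynomial_function p \<and> (\<forall>t\<in>{-1..1}. \<bar>\<psi> (arccos t) - p t\<bar> < \<epsilon>)"
    using Stone_Weierstrass_real_polynomial_function[OF compact_Icc cont \<epsilon>] by metis
  then obtain p where p: "real_polynomial_function p" "\<And>t. t \<in> {-1..1} \<Longrightarrow> \<bar>\<psi> (arccos t) - p t\<bar> < \<epsilon>"
    by blast
  from p(1) obtain a N where a: "p = (\<lambda>t. \<Sum>i\<le>N. a i * t ^ i)"
    unfolding real_polynomial_function_iff_sum by auto
  define P where "P x = (\<Sum>i\<le>N. a i * cos x ^ i)" for x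
  have contP: "continuous_on {0..pi} P" unfolding P_def by (intro continuous_intros)
  have cont\<Psi>: "continuous_on {0..pi} (\<lambda>x. \<psi> (arccos (cos x)))"
    by (intro continuous_on_compose2[OF cont] continuous_intros) auto
  have "- \<epsilon> \<le> fact m * (\<Sum>i\<le>N. a i * disc_moment m n i)"
  proof (rule disc_moment_functional_ge)
    show "cpsd (Suc m) (\<lambda>z. of_real ((\<lambda>t. \<psi> (arccos t)) (Re z)))"
      using Psi_class_imp_cpsd[OF \<psi> m] by simp
    fix t :: real assume "\<bar>t\<bar> \<le> 1"
    then have "t \<in> {-1..1}" by auto
    from p(2)[OF this] show "\<bar>\<psi> (arccos t) - (\<Sum>i\<le>N. a i * t ^ i)\<bar> \<le> \<epsilon>"
      unfolding a by simp
  qed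
  then have "- \<epsilon> / fact m \<le> (\<Sum>i\<le>N. a i * disc_moment m n i)"
    using divide_right_mono[of "- \<epsilon>" _ "fact m"] by fastforce
  moreover have "- \<epsilon> \<le> - \<epsilon> / fact m" using \<epsilon> by (simp add: divide_le_eq)
  ultimately have "- \<epsilon> \<le> (\<Sum>i\<le>N. a i * disc_moment m n i)" by linarith
  then have "pi / 2 ^ m * (- \<epsilon>) \<le> iterated_coeff m n P"
    unfolding P_def iterated_coeff_cos_polynomial by (rule mult_left_mono) simp
  moreover have "pi / 2 ^ m * \<epsilon> \<le> pi * \<epsilon>"
    using \<epsilon> by (intro mult_right_mono) (auto simp: divide_le_eq)
  moreover have "\<bar>iterated_coeff m n (\<lambda>x. \<psi> (arccos (cos x)) - P x)\<bar> \<le> pi * \<epsilon>"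
  proof (rule abs_iterated_coeff_le)
    fix x
    have "\<bar>\<psi> (arccos (cos x)) - p (cos x)\<bar> < \<epsilon>" by (rule p(2)) simp
    then show "\<bar>\<psi> (arccos (cos x)) - P x\<bar> \<le> \<epsilon>" unfolding a P_def by simp
  qed (intro continuous_intros cont\<Psi> contP)
  ultimately have "- (2 * pi * \<epsilon>) \<le> iterated_coeff m n (\<lambda>x. \<psi> (arccos (cos x)))"
    unfolding iterated_coeff_diff[OF cont\<Psi> contP] by (simp add: abs_le_iff)
  then show "0 \<le> iterated_coeff m n (\<lambda>x. \<psi> (arccos (cos x))) + e"
    by (simp add: \<epsilon>_def)
qed

section \<open>Smoothness\<close>

lemma two_minus_two_cos: "2 - 2 * cos t = (2 * sin (t / 2))\<^sup>2" for t :: real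
  using cos_double_sin[of "t / 2"] by (simp add: power_mult_distrib)

lemma two_minus_two_cos_le: "2 - 2 * cos t \<le> t\<^sup>2" for t :: real
proof -
  have "\<bar>2 * sin (t / 2)\<bar> \<le> \<bar>t\<bar>" using abs_sin_x_le_abs_x[of "t / 2"] by (simp add: abs_mult)
  then show ?thesis unfolding two_minus_two_cos by (simp add: abs_le_square_iff)
qed

text \<open>Up to sign, the eigenvalues of the scaled second difference tend to those of the second
  derivative.\<close>

lemma tendsto_two_minus_two_cos: "((\<lambda>h. (2 - 2 * cos (c * h)) / h\<^sup>2) \<longlongrightarrow> c\<^sup>2) (at 0)" for c :: real
proof -
  have "((\<lambda>h. 2 * sin (c * h / 2)) has_real_derivative c) (at 0)"
    by (rule derivative_eq_intros refl | simp)+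
  then have "((\<lambda>h. 2 * sin (c * h / 2) / h) \<longlongrightarrow> c) (at 0)" by (simp add: DERIV_def)
  then have "((\<lambda>h. (2 * sin (c * h / 2) / h)\<^sup>2) \<longlongrightarrow> c\<^sup>2) (at 0)" by (rule tendsto_power)
  then show ?thesis by (simp add: two_minus_two_cos power_divide)
qed

text \<open>Iterated second differences at zero, divided by h^(2K), stay bounded for the smooth part
  and for the remainder. On the series they give each a_n a nonnegative weight that tends to n^(2K)
  as h tends to 0.\<close>

lemma summable_weighted_coeffs:
  assumes sums: "\<And>x. \<bar>x\<bar> \<le> pi \<Longrightarrow> (\<lambda>n. a n * cos (real n * x)) sums g x"
    and summ: "summable (\<lambda>n. \<bar>a n\<bar>)" and nonneg: "\<And>n. m \<le> n \<Longrightarrow> 0 \<le> a n"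
    and bigo: "smooth_plus_bigo (2 * K) g"
  shows "summable (\<lambda>n. \<bar>a n\<bar> * real n ^ (2 * K))"
proof -
  \<comment> \<open>\<open>second_diff_funpow_sums\<close> asks for convergence at every point,
    while \<open>sums\<close> covers [-pi, pi]; hence a globally defined sum.\<close>
  define S where "S x = (\<Sum>n. a n * cos (real n * x))" for x
  have "summable (\<lambda>n. a n * cos (real n * x))" for x
  proof (rule summable_comparison_test'[OF summ])
    fix n
    show "norm (a n * cos (real n * x)) \<le> \<bar>a n\<bar>"
      using mult_left_mono[OF abs_cos_le_one[of "real n * x"] abs_ge_zero[of "a n"]]
      by (simp add: abs_mult)
  qed
  then have S: "(\<lambda>n. a n * cos (real n * x)) sums S x" for x
    unfolding S_def by (rule summable_sums)
  have g_eq: "g x = S x" if "\<bar>x\<bar> \<le> pi" for x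
    using sums[OF that] S[of x] by (rule sums_unique2)
  obtain s C \<delta> where s: "\<And>n. Ck_on n s UNIV" "C \<ge> 0" "\<delta> > 0"
    "\<And>x. \<bar>x\<bar> \<le> \<delta> \<Longrightarrow> \<bar>g x - s x\<bar> \<le> C * \<bar>x\<bar> ^ (2 * K)"
    using bigo unfolding smooth_plus_bigo_def by blast
  obtain B where B: "B \<ge> 0" "\<And>h. real K * \<bar>h\<bar> \<le> 1 \<Longrightarrow> \<bar>(second_diff h ^^ K) s 0\<bar> \<le> B * h ^ (2 * K)"
    using Ck_on_second_diff_funpow_le[OF s(1)] by blast
  \<comment> \<open>Ensures K h \<le> min 1 \<delta>, so both local bounds apply; the added 1 keeps
    the quotient meaningful for K = 0.\<close>
  define h0 where "h0 = min 1 \<delta> / (real K + 1)"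
  have h0: "h0 > 0" using s(3) by (simp add: h0_def)
  define L where "L = (\<Sum>n<m. \<bar>a n\<bar> * real n ^ (2 * K))"
  \<comment> \<open>The three parts bound the smooth function, the remainder on |y| \<le> K h, and
    the sign changes among the first \<open>m\<close> coefficients.\<close>
  define C1 where "C1 = B + 4 ^ K * (C * real K ^ (2 * K)) + 2 * L"
  have bound: "(\<Sum>n<N. \<bar>a n\<bar> * ((2 - 2 * cos (real n * h)) / h\<^sup>2) ^ K) \<le> C1" if h: "0 < h" "h \<le> h0" for h N
  proof -
    have "real K * h \<le> real K * h0" using h by (intro mult_left_mono) auto
    also have "\<dots> \<le> (real K + 1) * h0" using h0 by simp
    also have "\<dots> = min 1 \<delta>" by (simp add: h0_def)
    finally have Kh: "real K * h \<le> 1" "real K * h \<le> \<delta>" by auto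
    have "(second_diff h ^^ K) S 0 = (second_diff h ^^ K) g 0"
      by (rule second_diff_funpow_cong, rule g_eq[symmetric]) (use Kh h pi_gt3 in auto)
    also have "\<dots> = (second_diff h ^^ K) (\<lambda>x. s x + (g x - s x)) 0" by simp
    also have "\<dots> = (second_diff h ^^ K) s 0 + (second_diff h ^^ K) (\<lambda>x. g x - s x) 0"
      by (rule second_diff_funpow_add)
    finally have "\<bar>(second_diff h ^^ K) S 0\<bar>
        \<le> \<bar>(second_diff h ^^ K) s 0\<bar> + \<bar>(second_diff h ^^ K) (\<lambda>x. g x - s x) 0\<bar>"
      by (simp only: abs_triangle_ineq)
    also have "\<dots> \<le> B * h ^ (2 * K) + 4 ^ K * (C * (real K * h) ^ (2 * K))"
    proof (rule add_mono)
      show "\<bar>(second_diff h ^^ K) s 0\<bar> \<le> B * h ^ (2 * K)" using B(2)[of h] h Kh by simp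
      show "\<bar>(second_diff h ^^ K) (\<lambda>x. g x - s x) 0\<bar> \<le> 4 ^ K * (C * (real K * h) ^ (2 * K))"
      proof (rule abs_second_diff_funpow_le)
        fix y assume "\<bar>y\<bar> \<le> \<bar>0\<bar> + real K * \<bar>h\<bar>"
        then have y: "\<bar>y\<bar> \<le> real K * h" using h by simp
        then have "\<bar>g y - s y\<bar> \<le> C * \<bar>y\<bar> ^ (2 * K)" using Kh by (intro s(4)) simp
        also have "\<dots> \<le> C * (real K * h) ^ (2 * K)"
          using y s(2) by (intro mult_left_mono power_mono) auto
        finally show "\<bar>g y - s y\<bar> \<le> C * (real K * h) ^ (2 * K)" .
      qed
    qed
    finally have D: "\<bar>(second_diff h ^^ K) S 0\<bar> \<le> (B + 4 ^ K * (C * real K ^ (2 * K))) * h ^ (2 * K)"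
      by (simp add: power_mult_distrib algebra_simps)
    define q where "q n = (2 - 2 * cos (real n * h)) ^ K" for n
    have q0: "0 \<le> q n" for n unfolding q_def by (intro zero_le_power) simp
    have q_le: "q n \<le> real n ^ (2 * K) * h ^ (2 * K)" for n
    proof -
      have "q n \<le> ((real n * h)\<^sup>2) ^ K"
        unfolding q_def by (intro power_mono two_minus_two_cos_le) simp
      then show ?thesis by (simp add: power_mult power_mult_distrib)
    qed
    have "(\<lambda>n. (second_diff h ^^ K) (\<lambda>x. a n * cos (real n * x)) 0) sums (second_diff h ^^ K) S 0"
      by (rule second_diff_funpow_sums[OF S])
    then have "(\<lambda>n. (- 1) ^ K * ((second_diff h ^^ K) (\<lambda>x. a n * cos (real n * x)) 0)) sums
        ((- 1) ^ K * (second_diff h ^^ K) S 0)"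
      by (rule sums_mult)
    moreover have "(- 1) ^ K * ((second_diff h ^^ K) (\<lambda>x. a n * cos (real n * x)) 0) = a n * q n" for n
      unfolding second_diff_funpow_cos q_def by (simp flip: mult.assoc power_mult_distrib)
    ultimately have b: "(\<lambda>n. a n * q n) sums ((- 1) ^ K * (second_diff h ^^ K) S 0)" by simp
    \<comment> \<open>Taking absolute values affects only the first \<open>m\<close> terms, each by
      at most twice its modulus.\<close>
    have "(\<lambda>n. \<bar>a n * q n\<bar> - a n * q n) sums (\<Sum>n<m. \<bar>a n * q n\<bar> - a n * q n)"
      by (rule sums_finite) (use nonneg q0 in \<open>auto simp: not_less\<close>)
    from sums_add[OF this b] have abs_sums: "(\<lambda>n. \<bar>a n * q n\<bar>) sums
        ((\<Sum>n<m. \<bar>a n * q n\<bar> - a n * q n) + (- 1) ^ K * (second_diff h ^^ K) S 0)" by simp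
    have "(\<Sum>n<N. \<bar>a n\<bar> * q n) = (\<Sum>n<N. \<bar>a n * q n\<bar>)" using q0 by (simp add: abs_mult)
    also have "\<dots> \<le> (\<Sum>n<m. \<bar>a n * q n\<bar> - a n * q n) + (- 1) ^ K * (second_diff h ^^ K) S 0"
      by (rule sum_le_suminf[OF sums_summable[OF abs_sums], of "{..<N}", folded sums_unique[OF abs_sums]]) auto
    also have "(- 1) ^ K * (second_diff h ^^ K) S 0 \<le> \<bar>(second_diff h ^^ K) S 0\<bar>"
      using abs_ge_self[of "(- 1) ^ K * (second_diff h ^^ K) S 0"] by (simp add: abs_mult)
    also note D
    also have "(\<Sum>n<m. \<bar>a n * q n\<bar> - a n * q n) \<le> (\<Sum>n<m. 2 * (\<bar>a n\<bar> * real n ^ (2 * K)) * h ^ (2 * K))"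
    proof (rule sum_mono)
      fix n
      have "\<bar>a n * q n\<bar> - a n * q n \<le> 2 * (\<bar>a n\<bar> * q n)"
        using q0[of n] abs_ge_minus_self[of "a n * q n"] by (simp add: abs_mult mult.commute)
      also have "\<dots> \<le> 2 * (\<bar>a n\<bar> * (real n ^ (2 * K) * h ^ (2 * K)))"
        using q_le[of n] by (intro mult_left_mono) auto
      finally show "\<bar>a n * q n\<bar> - a n * q n \<le> 2 * (\<bar>a n\<bar> * real n ^ (2 * K)) * h ^ (2 * K)"
        by (simp add: mult.assoc)
    qed
    also have "\<dots> = 2 * L * h ^ (2 * K)"
      by (simp add: L_def sum_distrib_left sum_distrib_right)
    finally have "(\<Sum>n<N. \<bar>a n\<bar> * q n) \<le> C1 * h ^ (2 * K)"
      by (simp add: C1_def distrib_right)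
    then have "(\<Sum>n<N. \<bar>a n\<bar> * q n) / h ^ (2 * K) \<le> C1"
      using h by (simp add: pos_divide_le_eq)
    then show ?thesis
      by (simp add: q_def power_divide sum_divide_distrib flip: power_mult)
  qed
  have "(\<Sum>n<N. \<bar>a n\<bar> * real n ^ (2 * K)) \<le> C1" for N
  proof -
    \<comment> \<open>\<open>N\<close> is fixed while h tends to 0, so the limit passes through a
      finite sum; \<open>C1\<close> does not depend on \<open>N\<close>.\<close>
    have "((\<lambda>h. \<Sum>n<N. \<bar>a n\<bar> * ((2 - 2 * cos (real n * h)) / h\<^sup>2) ^ K) \<longlongrightarrow>
        (\<Sum>n<N. \<bar>a n\<bar> * ((real n)\<^sup>2) ^ K)) (at_right 0)"
      by (intro tendsto_intros tendsto_within_subset[OF tendsto_two_minus_two_cos]) auto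
    moreover have "\<forall>\<^sub>F h in at_right 0. (\<Sum>n<N. \<bar>a n\<bar> * ((2 - 2 * cos (real n * h)) / h\<^sup>2) ^ K) \<le> C1"
      unfolding eventually_at_right_field using h0 bound by (intro exI[of _ h0]) auto
    ultimately have "(\<Sum>n<N. \<bar>a n\<bar> * ((real n)\<^sup>2) ^ K) \<le> C1"
      by (intro tendsto_upperbound[of _ _ "at_right 0"]) auto
    then show ?thesis by (simp flip: power_mult)
  qed
  then show ?thesis by (intro summableI_nonneg_bounded) auto
qed

text \<open>The phase \<open>c\<close> closes the family under differentiation: a derivative adds
  pi/2 to the phase and multiplies the coefficients by n.\<close>

lemma Ck_on_cos_series:
  "summable (\<lambda>n. \<bar>a n\<bar>) \<Longrightarrow> summable (\<lambda>n. \<bar>a n\<bar> * real n ^ j) \<Longrightarrow>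
     Ck_on j (\<lambda>x. \<Sum>n. a n * cos (real n * x + c)) UNIV"
proof (induction j arbitrary: a c)
  case 0
  have "uniform_limit UNIV (\<lambda>N x. \<Sum>n<N. a n * cos (real n * x + c))
      (\<lambda>x. \<Sum>n. a n * cos (real n * x + c)) sequentially"
  proof (rule Weierstrass_m_test[OF _ 0(1)])
    fix n x
    show "norm (a n * cos (real n * x + c)) \<le> \<bar>a n\<bar>"
      using mult_left_mono[OF abs_cos_le_one[of "real n * x + c"] abs_ge_zero[of "a n"]]
      by (simp add: abs_mult)
  qed
  then show ?case
    unfolding Ck_on.simps(1)
    by (rule uniform_limit_theorem[rotated]) (simp_all add: always_eventually continuous_intros)
next
  case (Suc j)
  define b where "b n = a n * real n" for n
  have "summable (\<lambda>n. \<bar>a n\<bar> * real n ^ Suc i)" if "i \<le> j" for i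
  proof (rule summable_comparison_test'[OF Suc.prems(2)])
    fix n
    show "norm (\<bar>a n\<bar> * real n ^ Suc i) \<le> \<bar>a n\<bar> * real n ^ Suc j"
    proof (cases "n = 0")
      case False
      have "real n ^ Suc i \<le> real n ^ Suc j" using False that by (intro power_increasing) auto
      then show ?thesis by (simp add: mult_left_mono del: power_Suc)
    qed simp
  qed
  from this[of 0] this[of j] have b: "summable (\<lambda>n. \<bar>b n\<bar>)" "summable (\<lambda>n. \<bar>b n\<bar> * real n ^ j)"
    by (simp_all add: b_def abs_mult mult.assoc)
  have cos_shift: "b n * cos (real n * x + (c + pi / 2)) = - (sin (real n * x + c)) * real n * a n" for n x
  proof -
    have "cos (t + (c + pi / 2)) = - sin (t + c)" for t
      by (simp add: cos_add sin_add)
    then show ?thesis by (simp add: b_def)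
  qed
  have "((\<lambda>x. \<Sum>n. a n * cos (real n * x + c)) has_real_derivative
      (\<Sum>n. b n * cos (real n * x + (c + pi / 2)))) (at x)" for x
  proof (rule has_field_derivative_series'(2)[of UNIV])
    fix n x
    show "((\<lambda>x. a n * cos (real n * x + c)) has_real_derivative b n * cos (real n * x + (c + pi / 2)))
        (at x within UNIV)"
      unfolding cos_shift by (rule derivative_eq_intros refl | simp)+
  next
    have "uniform_limit UNIV (\<lambda>N x. \<Sum>n<N. b n * cos (real n * x + (c + pi / 2)))
        (\<lambda>x. \<Sum>n. b n * cos (real n * x + (c + pi / 2))) sequentially"
    proof (rule Weierstrass_m_test[OF _ b(1)])
      fix n x
      show "norm (b n * cos (real n * x + (c + pi / 2))) \<le> \<bar>b n\<bar>"
        using mult_left_mono[OF abs_cos_le_one[of "real n * x + (c + pi / 2)"] abs_ge_zero[of "b n"]]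
        by (simp add: abs_mult)
    qed
    then show "uniformly_convergent_on UNIV (\<lambda>N x. \<Sum>n<N. b n * cos (real n * x + (c + pi / 2)))"
      by (auto simp: uniformly_convergent_on_def)
  next
    show "summable (\<lambda>n. a n * cos (real n * 0 + c))"
      using summable_mult2[OF summable_rabs_cancel[OF Suc.prems(1)]] by simp
  qed simp_all
  moreover have "Ck_on j (\<lambda>x. \<Sum>n. b n * cos (real n * x + (c + pi / 2))) UNIV"
    by (rule Suc.IH[OF b])
  ultimately show ?case
    unfolding Ck_on.simps(2)
    by (intro exI[of _ "\<lambda>x. \<Sum>n. b n * cos (real n * x + (c + pi / 2))"]) simp
qed

text \<open>Of the two orders gained, |sin y| \<le> |y| gives one and integration the other.\<close>

lemma smooth_plus_bigo_sin_primitive: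
  assumes g: "continuous_on UNIV g" and bigo: "smooth_plus_bigo p g"
  shows "smooth_plus_bigo (p + 2) (sin_primitive g)"
proof -
  obtain s C \<delta> where s: "\<And>n. Ck_on n s UNIV" "C \<ge> 0" "\<delta> > 0"
    "\<And>x. \<bar>x\<bar> \<le> \<delta> \<Longrightarrow> \<bar>g x - s x\<bar> \<le> C * \<bar>x\<bar> ^ p"
    using bigo unfolding smooth_plus_bigo_def by blast
  have conts: "continuous_on UNIV s" using s(1)[of 0] by simp
  have "Ck_on n (sin_primitive s) UNIV" for n
  proof (cases n)
    case 0
    then show ?thesis by (simp add: continuous_on_sin_primitive[OF conts])
  next
    case (Suc k)
    have "Ck_on k (\<lambda>x. s x * sin x) UNIV" by (intro Ck_on_mult s(1) Ck_on_sin)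
    then show ?thesis unfolding Suc Ck_on.simps(2)
      by (intro exI[of _ "\<lambda>x. s x * sin x"]) (simp add: DERIV_sin_primitive[OF conts])
  qed
  moreover have "\<bar>sin_primitive g x - sin_primitive s x\<bar> \<le> C * \<bar>x\<bar> ^ (p + 2)" if "\<bar>x\<bar> \<le> \<delta>" for x
  proof -
    have "\<bar>sin_primitive g x - sin_primitive s x\<bar> \<le> C * \<bar>x\<bar> ^ Suc (Suc p)"
    proof (rule increment_bound_zero[OF _ _ _ that s(2)])
      fix y
      show "((\<lambda>x. sin_primitive g x - sin_primitive s x) has_real_derivative g y * sin y - s y * sin y) (at y)"
        by (intro DERIV_diff DERIV_sin_primitive g conts)
      assume y: "\<bar>y\<bar> \<le> \<delta>"
      have "\<bar>g y * sin y - s y * sin y\<bar> = \<bar>g y - s y\<bar> * \<bar>sin y\<bar>"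
        by (simp add: abs_mult flip: left_diff_distrib)
      also have "\<dots> \<le> (C * \<bar>y\<bar> ^ p) * \<bar>y\<bar>"
        using s(2) by (intro mult_mono s(4) y abs_sin_x_le_abs_x) auto
      finally show "\<bar>g y * sin y - s y * sin y\<bar> \<le> C * \<bar>y\<bar> ^ Suc p" by (simp add: mult_ac)
    qed simp
    then show ?thesis by simp
  qed
  ultimately show ?thesis using s(2,3) unfolding smooth_plus_bigo_def by blast
qed

lemma smooth_plus_bigo_sin_primitive_funpow:
  assumes "continuous_on UNIV g" "smooth_plus_bigo p g"
  shows "smooth_plus_bigo (p + 2 * m) ((sin_primitive ^^ m) g)"
proof (induction m)
  case (Suc m)
  show ?case
    using smooth_plus_bigo_sin_primitive[OF continuous_on_sin_primitive_funpow[OF assms(1)] Suc] by simp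
qed (simp add: assms)

lemma smooth_plus_bigo_cmult:
  assumes "smooth_plus_bigo p g"
  shows "smooth_plus_bigo p (\<lambda>x. c * g x)"
proof -
  obtain s C \<delta> where s: "\<And>n. Ck_on n s UNIV" "C \<ge> 0" "\<delta> > 0"
    "\<And>x. \<bar>x\<bar> \<le> \<delta> \<Longrightarrow> \<bar>g x - s x\<bar> \<le> C * \<bar>x\<bar> ^ p"
    using assms unfolding smooth_plus_bigo_def by blast
  have "Ck_on n (\<lambda>x. c * s x) UNIV" for n by (intro Ck_on_mult Ck_on_const s(1))
  moreover have "\<bar>c * g x - c * s x\<bar> \<le> \<bar>c\<bar> * C * \<bar>x\<bar> ^ p" if "\<bar>x\<bar> \<le> \<delta>" for x
    using mult_left_mono[OF s(4)[OF that] abs_ge_zero[of c]]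
    by (simp add: mult.assoc flip: right_diff_distrib abs_mult)
  ultimately show ?thesis using s(2,3) unfolding smooth_plus_bigo_def
    by (intro exI[of _ "\<lambda>x. c * s x"] exI[of _ "\<bar>c\<bar> * C"] exI[of _ \<delta>]) simp
qed

lemma smooth_plus_bigo_cong:
  assumes "smooth_plus_bigo p f" "0 < r" "\<And>x. \<bar>x\<bar> \<le> r \<Longrightarrow> f x = g x"
  shows "smooth_plus_bigo p g"
proof -
  obtain s C \<delta> where s: "\<And>n. Ck_on n s UNIV" "C \<ge> 0" "\<delta> > 0"
    "\<And>x. \<bar>x\<bar> \<le> \<delta> \<Longrightarrow> \<bar>f x - s x\<bar> \<le> C * \<bar>x\<bar> ^ p"
    using assms(1) unfolding smooth_plus_bigo_def by blast
  have "\<bar>g x - s x\<bar> \<le> C * \<bar>x\<bar> ^ p" if "\<bar>x\<bar> \<le> min \<delta> r" for x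
    using s(4)[of x] assms(3)[of x] that by simp
  with s(1-3) assms(2) show ?thesis unfolding smooth_plus_bigo_def
    by (intro exI[of _ s] exI[of _ C] exI[of _ "min \<delta> r"]) simp
qed

text \<open>The derivative of the primitive is divided by sin; this step confines the conclusion to
  the open interval.\<close>

lemma Ck_on_sin_primitive_D:
  assumes g: "continuous_on UNIV g" and "Ck_on (Suc n) (sin_primitive g) {0<..<pi}"
  shows "Ck_on n g {0<..<pi}"
proof -
  obtain f' where f': "\<forall>x\<in>{0<..<pi}. (sin_primitive g has_real_derivative f' x) (at x)" "Ck_on n f' {0<..<pi}"
    using assms(2) by auto
  have sin: "sin x \<noteq> 0" if "x \<in> {0<..<pi}" for x using sin_gt_zero[of x] that by auto
  have "f' x * inverse (sin x) = g x" if x: "x \<in> {0<..<pi}" for x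
  proof -
    have "f' x = g x * sin x"
      using f'(1) x DERIV_unique[OF _ DERIV_sin_primitive[OF g]] by blast
    then show ?thesis using sin[OF x] by simp
  qed
  moreover have "Ck_on n (\<lambda>x. f' x * inverse (sin x)) {0<..<pi}"
    by (intro Ck_on_mult f' Ck_on_inverse Ck_on_sin sin)
  ultimately show ?thesis by (intro Ck_on_cong[of "{0<..<pi}" "\<lambda>x. f' x * inverse (sin x)" g n]) auto
qed

lemma Ck_on_sin_primitive_funpow_D:
  assumes g: "continuous_on UNIV g"
  shows "Ck_on (n + m) ((sin_primitive ^^ m) g) {0<..<pi} \<Longrightarrow> Ck_on n g {0<..<pi}"
proof (induction m)
  case (Suc m)
  then have "Ck_on (n + m) ((sin_primitive ^^ m) g) {0<..<pi}"
    by (intro Ck_on_sin_primitive_D[OF continuous_on_sin_primitive_funpow[OF g]]) (simp del: Ck_on.simps)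
  then show ?case by (rule Suc.IH)
qed simp

theorem theorem1p1:
  fixes k d :: nat and \<psi> :: "real \<Rightarrow> real"
  assumes "d \<ge> 1" and "CARD('n::finite) = d + 1"
    and "\<psi> \<in> Psi_class TYPE('n)"
    and "times_differentiable_at_zero (2 * k) \<psi>"
  shows "has_continuous_derivatives_on (2 * k + (d - 1) div 2) \<psi> {0<..<pi}"
proof -
  define m where "m = (d - 1) div 2"
  \<comment> \<open>The even, 2 pi-periodic extension of \<psi>, continuous on the whole line as the
    lemmas on \<open>sin_primitive\<close> require.\<close>
  define \<Psi> where "\<Psi> x = \<psi> (arccos (cos x))" for x
  \<comment> \<open>The sign cancels the minus signs of the m integrations by parts.\<close>
  define g where "g x = (- 1) ^ m * (sin_primitive ^^ m) \<Psi> x" for x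
  define a where "a = cos_series_coeff g"
  \<comment> \<open>Here d is 2m + 1 or 2m + 2, so R^(d+1) has room for m + 1 complex
    coordinates.\<close>
  have card: "2 * Suc m \<le> CARD('n)" using assms(1,2) by (simp add: m_def)
  have cont\<psi>: "continuous_on {0..pi} \<psi>" using assms(3) by (simp add: Psi_class_def)
  have "continuous_on {-1..1} (\<lambda>t. \<psi> (arccos t))"
    by (rule continuous_on_compose2[OF cont\<psi> continuous_on_arccos']) (auto simp: arccos_lbound arccos_ubound)
  then have cont\<Psi>: "continuous_on UNIV \<Psi>"
    unfolding \<Psi>_def by (rule continuous_on_compose2[where f = cos]) (auto intro: continuous_intros)
  have contg: "continuous_on A g" for A
    unfolding g_def
    by (intro continuous_on_mult continuous_on_const
          continuous_on_subset[OF continuous_on_sin_primitive_funpow[OF cont\<Psi>] subset_UNIV])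
  have \<Psi>_eq: "\<psi> \<bar>x\<bar> = \<Psi> x" if "\<bar>x\<bar> \<le> pi" for x
    using that arccos_cos[of "\<bar>x\<bar>"] by (simp add: \<Psi>_def)
  have g_even: "g (- x) = g x" for x
    unfolding g_def by (subst sin_primitive_funpow_even[OF cont\<Psi>]) (simp_all add: \<Psi>_def)
  have coeff_nonneg: "0 \<le> cos_coeff g n" if "m \<le> n" for n
  proof -
    have "cos_coeff g ((n - m) + m) = (- 1) ^ m * ((- 1) ^ m * iterated_coeff m (n - m) \<Psi>)"
      unfolding g_def cos_coeff_cmult cos_coeff_sin_primitive_funpow[OF cont\<Psi>] ..
    also have "\<dots> = iterated_coeff m (n - m) \<Psi>" by (simp flip: mult.assoc power_mult_distrib)
    finally show ?thesis
      using that iterated_coeff_nonneg[OF assms(3) card, of "n - m"] by (simp add: \<Psi>_def[abs_def])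
  qed
  have "summable (\<lambda>n. 2 / pi * \<bar>cos_coeff g n\<bar>)"
    by (intro summable_mult summable_cos_coeff[OF contg coeff_nonneg])
  then have summ: "summable (\<lambda>n. \<bar>a n\<bar>)"
    by (rule summable_comparison_test'[of _ 0]) (auto simp: a_def cos_series_coeff_def abs_mult divide_right_mono)
  have sums: "(\<lambda>n. a n * cos (real n * x)) sums g x" if "\<bar>x\<bar> \<le> pi" for x
  proof -
    have "(\<lambda>n. a n * cos (real n * \<bar>x\<bar>)) sums g \<bar>x\<bar>"
      unfolding a_def by (rule cos_series_sums[OF contg]) (use summ that in \<open>auto simp: a_def\<close>)
    moreover have "g \<bar>x\<bar> = g x" using g_even[of x] by (simp add: abs_if)
    moreover have "cos (real n * \<bar>x\<bar>) = cos (real n * x)" for n by (simp add: abs_if)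
    ultimately show ?thesis by simp
  qed
  have "continuous_on {-1..1} (\<lambda>x. \<psi> \<bar>x\<bar>)"
    by (intro continuous_on_compose2[OF cont\<psi>] continuous_intros) (use pi_gt3 in auto)
  then have "smooth_plus_bigo (2 * k) (\<lambda>x. \<psi> \<bar>x\<bar>)"
    using assms(4) unfolding times_differentiable_at_zero_def
    by (rule smooth_plus_bigo_if_times_differentiable)
  then have "smooth_plus_bigo (2 * k) \<Psi>" by (rule smooth_plus_bigo_cong[OF _ pi_gt_zero \<Psi>_eq])
  then have "smooth_plus_bigo (2 * (k + m)) g"
    unfolding g_def distrib_left
    by (intro smooth_plus_bigo_cmult smooth_plus_bigo_sin_primitive_funpow[OF cont\<Psi>])
  moreover have "0 \<le> a n" if "m \<le> n" for n
    using coeff_nonneg[OF that] by (simp add: a_def cos_series_coeff_def)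
  ultimately have "summable (\<lambda>n. \<bar>a n\<bar> * real n ^ (2 * (k + m)))"
    by (intro summable_weighted_coeffs[OF sums summ])
  then have "Ck_on (2 * (k + m)) (\<lambda>x. \<Sum>n. a n * cos (real n * x + 0)) UNIV"
    by (rule Ck_on_cos_series[OF summ])
  from Ck_on_mult[OF Ck_on_const[of _ "(- 1) ^ m"] Ck_on_subset[OF this subset_UNIV]]
  have "Ck_on (2 * (k + m)) (\<lambda>x. (- 1) ^ m * (\<Sum>n. a n * cos (real n * x + 0))) {0<..<pi}" .
  moreover have "(- 1) ^ m * (\<Sum>n. a n * cos (real n * x + 0)) = (sin_primitive ^^ m) \<Psi> x"
    if "x \<in> {0<..<pi}" for x
  proof -
    have "(\<Sum>n. a n * cos (real n * x + 0)) = g x" using sums[of x] that by (simp add: sums_iff)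
    then show ?thesis by (simp add: g_def flip: mult.assoc power_mult_distrib)
  qed
  ultimately have "Ck_on (2 * (k + m)) ((sin_primitive ^^ m) \<Psi>) {0<..<pi}"
    by (rule Ck_on_cong[OF open_greaterThanLessThan, rotated])
  \<comment> \<open>2(k + m) = (2k + m) + m, and undoing the m primitives uses up the last
    summand.\<close>
  then have "Ck_on (2 * k + m) \<Psi> {0<..<pi}"
    using Ck_on_sin_primitive_funpow_D[OF cont\<Psi>, of "2 * k + m" m]
    by (simp add: mult_2 ac_simps del: Ck_on.simps)
  then have "Ck_on (2 * k + m) \<psi> {0<..<pi}"
    by (rule Ck_on_cong[OF open_greaterThanLessThan, rotated]) (simp add: \<Psi>_def arccos_cos)
  then show ?thesis
    unfolding m_def by (rule Ck_on_imp_has_continuous_derivatives_on[OF open_greaterThanLessThan])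
qed

end
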